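(* Let $R=k[x_1,\ldots,x_n]$ be a polynomial ring over a field $k$ in $n$ variables with its standard grading, let $M$ be a finitely generated graded $R$-module, and let $t\ge0$ be an integer. Then (a) $\operatorname{reg}_t(M)=\max\{b_i(M)-i\mid i\ge n-t\}$; (b) $a^*_t(M)=\max\{b_i(M)\mid i\ge n-t\}-n$.
   Context: $R_+=(x_1,\ldots,x_n)$. $H^i_{R_+}(M)$ is the $i$-th (graded) local cohomology module of $M$ with respect to $R_+$, and $a_i(M)=\sup\{r\mid H^i_{R_+}(M)_r\ne0\}$ (with $a_i(M)=-\infty$ if $H^i_{R_+}(M)=0$). The partial regularities are $\operatorname{reg}_t(M)=\max\{a_i(M)+i\mid 0\le i\le t\}$ and $a_t^*(M)=\max\{a_i(M)\mid 0\le i\le t\}$. $b_i(M)$ is the maximal degree of the generators of $F_i$ in a minimal graded free resolution $0\to F_s\to\cdots\to F_0\to M\to0$, with $b_i(M)=-\infty$ if $F_i=0$ (in particular for $i<0$ or $i>s$). *)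

theory Defs
  imports
    "HOL-Library.Poly_Mapping"
    "HOL-Library.Extended_Real"
    "HOL-Library.Cardinality"
begin

text \<open>The ring \<open>k[x\<^sub>i | i \<in> 'n]\<close>, as the monoid algebra of the exponent vectors; the number of
  variables is \<open>CARD('n)\<close>.\<close>

type_synonym ('n, 'k) mpoly = "('n \<Rightarrow>\<^sub>0 nat) \<Rightarrow>\<^sub>0 'k"

definition var :: "'n \<Rightarrow> ('n::finite, 'k::field) mpoly" where
  "var i = Poly_Mapping.single (Poly_Mapping.single i 1) 1"

definition homogeneous :: "nat \<Rightarrow> ('n::finite, 'k::field) mpoly set" where
  "homogeneous e = {p. \<forall>m \<in> Poly_Mapping.keys p. (\<Sum>i\<in>UNIV. Poly_Mapping.lookup m i) = e}"

text \<open>Ideals are the submodules of the ring over itself, that is, for the scalar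
  multiplication \<open>(*)\<close>.\<close>

definition irrelevant_ideal :: "('n::finite, 'k::field) mpoly set" where
  "irrelevant_ideal = module.span (*) (range var)"

primrec ideal_power :: "('n::finite, 'k::field) mpoly set \<Rightarrow> nat \<Rightarrow> ('n, 'k) mpoly set" where
  "ideal_power J 0 = UNIV"
| "ideal_power J (Suc l) = module.span (*) {p * q | p q. p \<in> J \<and> q \<in> ideal_power J l}"


text \<open>A graded module is given by its scalar multiplication \<open>s\<close> and the family \<open>G\<close> of its
  homogeneous components, which may lie in a larger ambient module. The module itself is
  the (internal) direct sum of the components, \<open>gcarrier G\<close>. The ambient module is
  there so that the terms of a complex can share one type.\<close>

definition gcarrier :: "(int \<Rightarrow> 'm::ab_group_add set) \<Rightarrow> 'm set" where
  "gcarrier G = {\<Sum>d\<in>D. f d | D f. finite D \<and> (\<forall>d\<in>D. f d \<in> G d)}"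

definition graded_module ::
  "(('n::finite, 'k::field) mpoly \<Rightarrow> 'm::ab_group_add \<Rightarrow> 'm) \<Rightarrow> (int \<Rightarrow> 'm set) \<Rightarrow> bool" where
  "graded_module s G \<longleftrightarrow>
     module s \<and>
     (\<forall>d. 0 \<in> G d \<and> (\<forall>x\<in>G d. \<forall>y\<in>G d. x - y \<in> G d)) \<and>
     (\<forall>e d. \<forall>p\<in>homogeneous e. \<forall>x\<in>G d. s p x \<in> G (d + int e)) \<and>
     (\<forall>D f. finite D \<longrightarrow> (\<forall>d\<in>D. f d \<in> G d) \<longrightarrow> (\<Sum>d\<in>D. f d) = 0 \<longrightarrow> (\<forall>d\<in>D. f d = 0))"

definition finitely_generated ::
  "(('n::finite, 'k::field) mpoly \<Rightarrow> 'm::ab_group_add \<Rightarrow> 'm) \<Rightarrow> (int \<Rightarrow> 'm set) \<Rightarrow> bool" where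
  "finitely_generated s G \<longleftrightarrow> (\<exists>S. finite S \<and> S \<subseteq> gcarrier G \<and> module.span s S = gcarrier G)"

text \<open>Homomorphisms of degree 0; only the values on the carrier matter.\<close>

definition graded_hom ::
  "(('n::finite, 'k::field) mpoly \<Rightarrow> 'a::ab_group_add \<Rightarrow> 'a) \<Rightarrow> (int \<Rightarrow> 'a set) \<Rightarrow>
   (('n, 'k) mpoly \<Rightarrow> 'b::ab_group_add \<Rightarrow> 'b) \<Rightarrow> (int \<Rightarrow> 'b set) \<Rightarrow> ('a \<Rightarrow> 'b) \<Rightarrow> bool" where
  "graded_hom s G s' G' f \<longleftrightarrow>
     (\<forall>x\<in>gcarrier G. \<forall>y\<in>gcarrier G. f (x + y) = f x + f y) \<and>
     (\<forall>p. \<forall>x\<in>gcarrier G. f (s p x) = s' p (f x)) \<and>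
     (\<forall>d. f ` G d \<subseteq> G' d)"


text \<open>Injectivity in the category of graded modules and homomorphisms of degree 0. HOL
  cannot quantify over the type of the test modules \<open>A \<subseteq> B\<close>, so they range over all graded
  modules on the type of the ring. These include the homogeneous ideals of all shifts of the
  ring, so by Baer's criterion nothing is lost. Moreover injectivity is only used as a
  hypothesis, where fewer test modules make for a weaker assumption.\<close>

definition graded_injective ::
  "(('n::finite, 'k::field) mpoly \<Rightarrow> 'e::ab_group_add \<Rightarrow> 'e) \<Rightarrow> (int \<Rightarrow> 'e set) \<Rightarrow> bool" where
  "graded_injective s E \<longleftrightarrow>
     graded_module s E \<and>
     (\<forall>(sB :: ('n, 'k) mpoly \<Rightarrow> ('n, 'k) mpoly \<Rightarrow> ('n, 'k) mpoly) A B f.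
        graded_module sB B \<and> graded_module sB A \<and> (\<forall>d. A d \<subseteq> B d) \<and> graded_hom sB A s E f \<longrightarrow>
        (\<exists>g. graded_hom sB B s E g \<and> (\<forall>x\<in>gcarrier A. g x = f x)))"

text \<open>\<open>0 \<rightarrow> M \<rightarrow> I\<^sup>0 \<rightarrow> I\<^sup>1 \<rightarrow> \<dots>\<close> exact, with coaugmentation \<open>\<eta>\<close> and \<open>dI i\<close> mapping \<open>I i\<close> to
  \<open>I (Suc i)\<close>.\<close>

definition graded_injective_resolution ::
  "(('n::finite, 'k::field) mpoly \<Rightarrow> 'm::ab_group_add \<Rightarrow> 'm) \<Rightarrow> (int \<Rightarrow> 'm set) \<Rightarrow>
   (('n, 'k) mpoly \<Rightarrow> 'e::ab_group_add \<Rightarrow> 'e) \<Rightarrow> (nat \<Rightarrow> int \<Rightarrow> 'e set) \<Rightarrow>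
   ('m \<Rightarrow> 'e) \<Rightarrow> (nat \<Rightarrow> 'e \<Rightarrow> 'e) \<Rightarrow> bool" where
  "graded_injective_resolution s M sI I \<eta> dI \<longleftrightarrow>
     (\<forall>i. graded_injective sI (I i)) \<and>
     graded_hom s M sI (I 0) \<eta> \<and>
     (\<forall>i. graded_hom sI (I i) sI (I (Suc i)) (dI i)) \<and>
     inj_on \<eta> (gcarrier M) \<and>
     \<eta> ` gcarrier M = {x \<in> gcarrier (I 0). dI 0 x = 0} \<and>
     (\<forall>i. dI i ` gcarrier (I i) = {x \<in> gcarrier (I (Suc i)). dI (Suc i) x = 0})"

text \<open>The degree \<open>r\<close> component of \<open>\<Gamma>\<^sub>J(N)\<close>, the submodule of the elements annihilated by some
  power of the ideal \<open>J\<close>.\<close>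

definition torsion_part ::
  "('n::finite, 'k::field) mpoly set \<Rightarrow> (('n, 'k) mpoly \<Rightarrow> 'e::ab_group_add \<Rightarrow> 'e) \<Rightarrow>
   (int \<Rightarrow> 'e set) \<Rightarrow> int \<Rightarrow> 'e set" where
  "torsion_part J s N r = {x \<in> N r. \<exists>l. \<forall>p\<in>ideal_power J l. s p x = 0}"

text \<open>Local cohomology as the right derived functor of \<open>\<Gamma>\<close> for \<open>R\<^sub>+\<close>: the degree \<open>r\<close> component
  of the \<open>i\<close>-th cohomology module of the complex \<open>\<Gamma>(I)\<close>, for an injective resolution \<open>I\<close>.\<close>

definition lc_cocycles ::
  "(('n::finite, 'k::field) mpoly \<Rightarrow> 'e::ab_group_add \<Rightarrow> 'e) \<Rightarrow> (nat \<Rightarrow> int \<Rightarrow> 'e set) \<Rightarrow>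
   (nat \<Rightarrow> 'e \<Rightarrow> 'e) \<Rightarrow> nat \<Rightarrow> int \<Rightarrow> 'e set" where
  "lc_cocycles sI I dI i r = {z \<in> torsion_part irrelevant_ideal sI (I i) r. dI i z = 0}"

definition lc_coboundaries ::
  "(('n::finite, 'k::field) mpoly \<Rightarrow> 'e::ab_group_add \<Rightarrow> 'e) \<Rightarrow> (nat \<Rightarrow> int \<Rightarrow> 'e set) \<Rightarrow>
   (nat \<Rightarrow> 'e \<Rightarrow> 'e) \<Rightarrow> nat \<Rightarrow> int \<Rightarrow> 'e set" where
  "lc_coboundaries sI I dI i r =
     (case i of 0 \<Rightarrow> {0} | Suc j \<Rightarrow> dI j ` torsion_part irrelevant_ideal sI (I j) r)"

definition local_cohomology ::
  "(('n::finite, 'k::field) mpoly \<Rightarrow> 'e::ab_group_add \<Rightarrow> 'e) \<Rightarrow> (nat \<Rightarrow> int \<Rightarrow> 'e set) \<Rightarrow>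
   (nat \<Rightarrow> 'e \<Rightarrow> 'e) \<Rightarrow> nat \<Rightarrow> int \<Rightarrow> 'e set set" where
  "local_cohomology sI I dI i r =
     lc_cocycles sI I dI i r //
       {(x, y). x \<in> lc_cocycles sI I dI i r \<and> y \<in> lc_cocycles sI I dI i r \<and>
                x - y \<in> lc_coboundaries sI I dI i r}"

text \<open>The zero class of the quotient is the coset \<open>lc_coboundaries sI I dI i r\<close>. In \<open>ereal\<close>,
  \<open>Sup {} = -\<infinity>\<close>.\<close>

definition a_inv ::
  "(('n::finite, 'k::field) mpoly \<Rightarrow> 'e::ab_group_add \<Rightarrow> 'e) \<Rightarrow> (nat \<Rightarrow> int \<Rightarrow> 'e set) \<Rightarrow>
   (nat \<Rightarrow> 'e \<Rightarrow> 'e) \<Rightarrow> nat \<Rightarrow> ereal" where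
  "a_inv sI I dI i =
     Sup {ereal (real_of_int r) | r. local_cohomology sI I dI i r \<noteq> {lc_coboundaries sI I dI i r}}"

definition partial_reg ::
  "(('n::finite, 'k::field) mpoly \<Rightarrow> 'e::ab_group_add \<Rightarrow> 'e) \<Rightarrow> (nat \<Rightarrow> int \<Rightarrow> 'e set) \<Rightarrow>
   (nat \<Rightarrow> 'e \<Rightarrow> 'e) \<Rightarrow> nat \<Rightarrow> ereal" where
  "partial_reg sI I dI t = Max {a_inv sI I dI i + ereal (real i) | i. i \<le> t}"

definition partial_a_star ::
  "(('n::finite, 'k::field) mpoly \<Rightarrow> 'e::ab_group_add \<Rightarrow> 'e) \<Rightarrow> (nat \<Rightarrow> int \<Rightarrow> 'e set) \<Rightarrow>
   (nat \<Rightarrow> 'e \<Rightarrow> 'e) \<Rightarrow> nat \<Rightarrow> ereal" where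
  "partial_a_star sI I dI t = Max {a_inv sI I dI i | i. i \<le> t}"


definition homogeneous_basis ::
  "(('n::finite, 'k::field) mpoly \<Rightarrow> 'f::ab_group_add \<Rightarrow> 'f) \<Rightarrow> (int \<Rightarrow> 'f set) \<Rightarrow> 'f set \<Rightarrow> bool"
  where
  "homogeneous_basis s F B \<longleftrightarrow>
     finite B \<and> B \<subseteq> (\<Union>r. F r) \<and> \<not> module.dependent s B \<and> module.span s B = gcarrier F"

text \<open>\<open>0 \<rightarrow> F\<^sub>l \<rightarrow> \<dots> \<rightarrow> F\<^sub>0 \<rightarrow> M \<rightarrow> 0\<close> exact, with augmentation \<open>\<epsilon>\<close>, \<open>\<delta> i\<close> mapping \<open>F (Suc i)\<close> to
  \<open>F i\<close>, and \<open>B i\<close> the chosen homogeneous generators of \<open>F i\<close>. Minimality means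
  \<open>\<delta>(F\<^sub>i\<^sub>+\<^sub>1) \<subseteq> R\<^sub>+ F\<^sub>i\<close>.\<close>

definition minimal_graded_free_resolution ::
  "(('n::finite, 'k::field) mpoly \<Rightarrow> 'm::ab_group_add \<Rightarrow> 'm) \<Rightarrow> (int \<Rightarrow> 'm set) \<Rightarrow>
   (('n, 'k) mpoly \<Rightarrow> 'f::ab_group_add \<Rightarrow> 'f) \<Rightarrow> (nat \<Rightarrow> int \<Rightarrow> 'f set) \<Rightarrow> (nat \<Rightarrow> 'f set) \<Rightarrow>
   ('f \<Rightarrow> 'm) \<Rightarrow> (nat \<Rightarrow> 'f \<Rightarrow> 'f) \<Rightarrow> bool" where
  "minimal_graded_free_resolution s M sF F B \<epsilon> \<delta> \<longleftrightarrow>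
     (\<forall>i. graded_module sF (F i) \<and> homogeneous_basis sF (F i) (B i)) \<and>
     (\<exists>l. \<forall>i>l. gcarrier (F i) = {0}) \<and>
     graded_hom sF (F 0) s M \<epsilon> \<and>
     (\<forall>i. graded_hom sF (F (Suc i)) sF (F i) (\<delta> i)) \<and>
     \<epsilon> ` gcarrier (F 0) = gcarrier M \<and>
     \<delta> 0 ` gcarrier (F 1) = {x \<in> gcarrier (F 0). \<epsilon> x = 0} \<and>
     (\<forall>i. \<delta> (Suc i) ` gcarrier (F (Suc (Suc i))) = {x \<in> gcarrier (F (Suc i)). \<delta> i x = 0}) \<and>
     (\<forall>i. \<delta> i ` gcarrier (F (Suc i)) \<subseteq>
        module.span sF {sF p x | p x. p \<in> irrelevant_ideal \<and> x \<in> gcarrier (F i)})"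

definition b_inv :: "(nat \<Rightarrow> int \<Rightarrow> 'f set) \<Rightarrow> (nat \<Rightarrow> 'f set) \<Rightarrow> int \<Rightarrow> ereal" where
  "b_inv F B i =
     (if i < 0 then -\<infinity> else Sup {ereal (real_of_int r) | r. B (nat i) \<inter> F (nat i) r \<noteq> {}})"

end

theory Submission
  imports Defs
begin

text \<open>Let \<open>n\<close> be the number of variables. Two facts are combined.

  First, \<open>Ext\<^sup>i(k, M)\<^sub>r\<close>, the cohomology of the socles of an injective resolution, is nonzero iff
  \<open>F\<^sub>n\<^sub>-\<^sub>i\<close> has a generator of degree \<open>r + n\<close>: both conditions are equivalent to the nonvanishing of the
  Koszul cohomology \<open>H\<^sup>i(x; M)\<^sub>r\<close>, by dimension shifting along the two resolutions. Koszul cohomology of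
  an injective module lives in degree \<open>0\<close> only, and that of a free module in degree \<open>n\<close> only.

  Second, local cohomology is compared with \<open>Ext(k, M)\<close>. If \<open>Ext\<^sup>i(k, M)\<close> vanishes in all degrees
  \<open>\<ge> r\<close>, then so does \<open>H\<^sup>i(M)\<^sub>r\<close>; and if \<open>Ext\<^sup>i(k, M)\<^sub>r \<noteq> 0\<close> while \<open>Ext\<^sup>i\<^sup>-\<^sup>1(k, M)\<close> vanishes in all
  degrees \<open>> r\<close>, then \<open>H\<^sup>i(M)\<^sub>r \<noteq> 0\<close>. Induction on \<open>i\<close> gives, from \<open>Ext\<^sup>i(k, M)\<^sub>r \<noteq> 0\<close>, some
  \<open>i' \<le> i\<close> and \<open>r' \<ge> r\<close> with \<open>r' + i' \<ge> r + i\<close> and \<open>H\<^sup>i\<^sup>'(M)\<^sub>r\<^sub>' \<noteq> 0\<close>, which yields both formulas.\<close>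

section \<open>Koszul cochains\<close>

text \<open>The Koszul complex on the variables resolves \<open>k\<close>, so its cohomology with
  coefficients in \<open>M\<close> is Ext(k, M); it is also self-dual, which turns position n - j in
  degree r into Tor_j(k, M) in degree r + n. This is the origin of the shift by n, and minimality
  makes Tor_j(k, M) = F_j / R_+ F_j a count of generators. Neither functor is constructed: only the
  vanishing of Koszul cohomology at one position and in one degree is carried along short exact
  sequences, so no isomorphism between cohomology groups has to be built. Ext(k, M) and local
  cohomology cannot be matched one index at a time. A socle cocycle with nonzero Ext class may be
  the image of a torsion element outside the socle, and then it is zero in local cohomology; in that
  case there is a nonzero Ext class one position lower in a strictly larger degree. This exchange is
  why maxima over i \<le> t are compared: it lowers neither the degree nor the sum of degree and
  position, the quantities of (b) and (a).\<close>

text \<open>Koszul cochains for a list of \<open>n\<close> variables are indexed by Boolean lists of length \<open>n\<close>, the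
  characteristic functions of subsets. In internal degree \<open>r\<close>, a cochain of cohomological degree \<open>p\<close>
  takes values in \<open>N (r + p)\<close>. Degrees are integers, so that \<open>p - 1\<close> is not truncated.\<close>

definition ones :: "bool list \<Rightarrow> int" where
  "ones bs = int (count_list bs True)"

lemma ones_simps [simp]: "ones [] = 0" "ones (b # bs) = ones bs + (if b then 1 else 0)"
  by (auto simp: ones_def)

lemma ones_eq_0_iff: "length bs = n \<and> ones bs = 0 \<longleftrightarrow> bs = replicate n False"
proof (induction bs arbitrary: n)
  case (Cons b bs)
  have "ones bs \<ge> 0" by (simp add: ones_def)
  then show ?case using Cons[of "n - 1"] by (cases n) auto
qed auto

lemma ones_le: "ones bs \<le> int (length bs)"
  by (simp add: ones_def count_le_length)

lemma ones_eq_length_iff: "length bs = n \<and> ones bs = int n \<longleftrightarrow> bs = replicate n True"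
proof (induction bs arbitrary: n)
  case (Cons b bs)
  show ?case using Cons[of "n - 1"] ones_le[of bs] by (cases n) auto
qed auto

text \<open>Total functions with prescribed support make the cochain operations pointwise and
  equality of cochains plain equality. Membership in \<open>N\<close> is also asked off the support,
  where it says that 0 lies in \<open>N\<close>, so that values can be estimated without a case
  distinction.\<close>

definition cochains :: "nat \<Rightarrow> int \<Rightarrow> int \<Rightarrow> (int \<Rightarrow> 'a::zero set) \<Rightarrow> (bool list \<Rightarrow> 'a) set" where
  "cochains n p r N =
     {f. \<forall>bs. f bs \<in> N (r + ones bs) \<and> (f bs \<noteq> 0 \<longrightarrow> length bs = n \<and> ones bs = p)}"

text \<open>The empty list is no index once there is a first variable. With the default 0 there,
  every cochain for a nonempty list of variables is a join.\<close>

definition join :: "(bool list \<Rightarrow> 'a::zero) \<Rightarrow> (bool list \<Rightarrow> 'a) \<Rightarrow> bool list \<Rightarrow> 'a" where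
  "join f g bs = (case bs of [] \<Rightarrow> 0 | b # cs \<Rightarrow> if b then g cs else f cs)"

lemma join_simps [simp]:
  "join f g [] = 0" "join f g (False # bs) = f bs" "join f g (True # bs) = g bs"
  by (simp_all add: join_def)

lemma join_cong_iff: "join f g = join f' g' \<longleftrightarrow> f = f' \<and> g = g'"
proof
  assume "join f g = join f' g'"
  then have "join f g bs = join f' g' bs" for bs by simp
  then show "f = f' \<and> g = g'"
    by (metis ext join_simps(2,3))
qed simp

lemma join_eq_zero_iff: "join f g = (\<lambda>_. 0) \<longleftrightarrow> f = (\<lambda>_. 0) \<and> g = (\<lambda>_. 0)"
proof -
  have "(\<lambda>_. 0) = join (\<lambda>_. 0) (\<lambda>_. 0)"
    by (auto simp: join_def fun_eq_iff split: list.splits)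
  then show ?thesis by (metis join_cong_iff)
qed

text \<open>The Koszul differential as that of the iterated mapping cone: for the first variable \<open>w\<close> a
  cochain is a pair \<open>join f g\<close>, with differential \<open>(f, g) \<mapsto> (df, w f - dg)\<close>.\<close>

primrec koszul_d :: "('n \<Rightarrow> 'a::ab_group_add \<Rightarrow> 'a) \<Rightarrow> 'n list \<Rightarrow> (bool list \<Rightarrow> 'a) \<Rightarrow> bool list \<Rightarrow> 'a" where
  "koszul_d x [] f = (\<lambda>_. 0)"
| "koszul_d x (w # vs) f =
     join (koszul_d x vs (\<lambda>bs. f (False # bs)))
          (\<lambda>bs. x w (f (False # bs)) - koszul_d x vs (\<lambda>bs. f (True # bs)) bs)"

text \<open>An index with head True has one True more than its tail. This lowers the position of the
  second component to \<open>p - 1\<close> and, since values lie in degree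
  \<open>r + ones bs\<close>, raises its internal degree to \<open>r + 1\<close>.\<close>

lemma join_in_cochains_iff:
  assumes "\<And>d. 0 \<in> N d"
  shows "join f g \<in> cochains (Suc n) p r N \<longleftrightarrow>
    f \<in> cochains n p r N \<and> g \<in> cochains n (p - 1) (r + 1) N"
proof -
  have "join f g \<in> cochains (Suc n) p r N \<longleftrightarrow>
     (\<forall>bs b. join f g (b # bs) \<in> N (r + ones (b # bs)) \<and>
        (join f g (b # bs) \<noteq> 0 \<longrightarrow> length bs = n \<and> ones (b # bs) = p))"
    unfolding cochains_def mem_Collect_eq
    using assms by (auto simp: join_def split: list.splits)
  also have "\<dots> \<longleftrightarrow> f \<in> cochains n p r N \<and> g \<in> cochains n (p - 1) (r + 1) N"
    unfolding cochains_def all_bool_eq mem_Collect_eq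
    by (simp add: algebra_simps eq_diff_eq) (auto simp: algebra_simps)
  finally show ?thesis .
qed

lemma cochains_SucE:
  assumes "h \<in> cochains (Suc n) p r N" "\<And>d. 0 \<in> N d"
  obtains f g where "h = join f g" "f \<in> cochains n p r N" "g \<in> cochains n (p - 1) (r + 1) N"
proof -
  have "h [] = 0" using assms(1) by (auto simp: cochains_def)
  then have "h = join (\<lambda>bs. h (False # bs)) (\<lambda>bs. h (True # bs))"
    by (auto simp: fun_eq_iff join_def split: list.splits)
  then show thesis using that assms join_in_cochains_iff by metis
qed

lemma cochains_trivial:
  assumes "f \<in> cochains n p r N" "p < 0 \<or> p > int n"
  shows "f = (\<lambda>_. 0)"
proof
  fix bs
  have "0 \<le> ones bs" "ones bs \<le> int (length bs)" by (simp add: ones_def, rule ones_le)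
  then show "f bs = 0" using assms unfolding cochains_def by force
qed

text \<open>At positions 0 and n there is only one index, all False or all True. The two ends of the
  complex are thus copies of \<open>N r\<close> and \<open>N (r + int n)\<close>.\<close>

definition bottom :: "nat \<Rightarrow> 'a::zero \<Rightarrow> bool list \<Rightarrow> 'a" where
  "bottom n e bs = (if bs = replicate n False then e else 0)"

definition top_cell :: "nat \<Rightarrow> 'a::zero \<Rightarrow> bool list \<Rightarrow> 'a" where
  "top_cell n e bs = (if bs = replicate n True then e else 0)"

lemma bottom_inj: "bottom n e = bottom n e' \<longleftrightarrow> e = e'"
  by (metis bottom_def)

lemma top_cell_inj: "top_cell n e = top_cell n e' \<longleftrightarrow> e = e'"
  by (metis top_cell_def)

lemma bottom_Suc: "bottom (Suc n) e = join (bottom n e) (\<lambda>_. 0)"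
  by (auto simp: fun_eq_iff bottom_def join_def split: list.splits)

lemma top_cell_Suc: "top_cell (Suc n) e = join (\<lambda>_. 0) (top_cell n e)"
  by (auto simp: fun_eq_iff top_cell_def join_def split: list.splits)

lemma bottom_in_cochains:
  assumes "\<And>d. 0 \<in> N d" "e \<in> N r"
  shows "bottom n e \<in> cochains n 0 r N"
  using assms ones_eq_0_iff[of "replicate n False" n] by (auto simp: cochains_def bottom_def)

lemma top_cell_in_cochains:
  assumes "\<And>d. 0 \<in> N d" "e \<in> N (r + int n)"
  shows "top_cell n e \<in> cochains n (int n) r N"
  using assms ones_eq_length_iff[of "replicate n True" n] by (auto simp: cochains_def top_cell_def)

lemma cochains_0E:
  assumes "f \<in> cochains n 0 r N"
  obtains e where "e \<in> N r" "f = bottom n e"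
proof
  have "ones (replicate n False) = 0" using ones_eq_0_iff by metis
  then show "f (replicate n False) \<in> N r"
    using assms unfolding cochains_def by (metis (no_types, lifting) add.right_neutral mem_Collect_eq)
  show "f = bottom n (f (replicate n False))"
    using assms ones_eq_0_iff unfolding cochains_def by (fastforce simp: fun_eq_iff bottom_def)
qed

lemma cochains_topE:
  assumes "f \<in> cochains n (int n) r N"
  obtains e where "e \<in> N (r + int n)" "f = top_cell n e"
proof
  have "ones (replicate n True) = int n" using ones_eq_length_iff by metis
  then show "f (replicate n True) \<in> N (r + int n)"
    using assms unfolding cochains_def by (metis (no_types, lifting) mem_Collect_eq)
  show "f = top_cell n (f (replicate n True))"
    using assms ones_eq_length_iff unfolding cochains_def by (fastforce simp: fun_eq_iff top_cell_def)
qed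

section \<open>Acyclicity at one position and degree; coregular and regular sequences\<close>

definition koszul_acyclic :: "('n \<Rightarrow> 'a::ab_group_add \<Rightarrow> 'a) \<Rightarrow> (int \<Rightarrow> 'a set) \<Rightarrow> 'n list \<Rightarrow> int \<Rightarrow> int \<Rightarrow> bool" where
  "koszul_acyclic x N vs p r \<longleftrightarrow>
     (\<forall>f\<in>cochains (length vs) p r N. koszul_d x vs f = (\<lambda>_. 0) \<longrightarrow>
        (\<exists>g\<in>cochains (length vs) (p - 1) r N. koszul_d x vs g = f))"

text \<open>The degree \<open>d\<close> part of (vs) N. The recursion peels off one variable at a
  time, as the mapping cone does.\<close>

primrec var_multiples :: "('n \<Rightarrow> 'a::ab_group_add \<Rightarrow> 'a) \<Rightarrow> (int \<Rightarrow> 'a set) \<Rightarrow> 'n list \<Rightarrow> int \<Rightarrow> 'a set" where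
  "var_multiples x N [] d = {0}"
| "var_multiples x N (w # vs) d = {x w a + b | a b. a \<in> N (d - 1) \<and> b \<in> var_multiples x N vs d}"

text \<open>The dual of a regular sequence, read from the end of the list: each variable acts
  surjectively on the elements killed by the variables after it.\<close>

primrec coregular :: "('n \<Rightarrow> 'a::ab_group_add \<Rightarrow> 'a) \<Rightarrow> (int \<Rightarrow> 'a set) \<Rightarrow> 'n list \<Rightarrow> bool" where
  "coregular x N [] \<longleftrightarrow> True"
| "coregular x N (w # vs) \<longleftrightarrow> coregular x N vs \<and>
     (\<forall>d. \<forall>e\<in>N d. (\<forall>v\<in>set vs. x v e = 0) \<longrightarrow>
        (\<exists>e'\<in>N (d - 1). x w e' = e \<and> (\<forall>v\<in>set vs. x v e' = 0)))"

text \<open>Each variable is a nonzerodivisor modulo the multiples of the variables after it.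
  Reading from the end of the list matches the order in which the cones are formed.\<close>

primrec regular :: "('n \<Rightarrow> 'a::ab_group_add \<Rightarrow> 'a) \<Rightarrow> (int \<Rightarrow> 'a set) \<Rightarrow> 'n list \<Rightarrow> bool" where
  "regular x N [] \<longleftrightarrow> True"
| "regular x N (w # vs) \<longleftrightarrow> regular x N vs \<and>
     (\<forall>d. \<forall>e\<in>N d. x w e \<in> var_multiples x N vs (d + 1) \<longrightarrow> e \<in> var_multiples x N vs d)"

text \<open>Of a graded module only commuting additive operators of degree 1 and a family of
  subgroups are kept. Kernels and images of the maps of a resolution are then instances after a
  short check.\<close>

locale koszul_module =
  fixes x :: "'n \<Rightarrow> 'a::ab_group_add \<Rightarrow> 'a" and N :: "int \<Rightarrow> 'a set"
  assumes x_add: "x v (a + b) = x v a + x v b"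
    and x_comm: "x u (x v a) = x v (x u a)"
    and zero_mem: "0 \<in> N d"
    and diff_mem: "a \<in> N d \<Longrightarrow> b \<in> N d \<Longrightarrow> a - b \<in> N d"
    and x_mem: "a \<in> N d \<Longrightarrow> x v a \<in> N (d + 1)"
begin

lemma x_zero [simp]: "x v 0 = 0"
  using x_add[of v 0 0] by simp

lemma x_diff: "x v (a - b) = x v a - x v b"
  using x_add[of v "a - b" b] by (simp add: algebra_simps)

lemma uminus_mem: "a \<in> N d \<Longrightarrow> - a \<in> N d"
  using diff_mem[OF zero_mem] by force

lemma add_mem: "a \<in> N d \<Longrightarrow> b \<in> N d \<Longrightarrow> a + b \<in> N d"
  using diff_mem uminus_mem by (metis diff_minus_eq_add)

lemma koszul_d_join:
  "koszul_d x (w # vs) (join f g) = join (koszul_d x vs f) (\<lambda>bs. x w (f bs) - koszul_d x vs g bs)"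
  by simp

lemma koszul_d_diff: "koszul_d x vs (\<lambda>bs. f bs - g bs) = (\<lambda>bs. koszul_d x vs f bs - koszul_d x vs g bs)"
proof (induction vs arbitrary: f g)
  case (Cons w vs)
  show ?case
    by (auto simp: Cons x_diff fun_eq_iff join_def split: list.splits)
qed simp

lemma koszul_d_zero [simp]: "koszul_d x vs (\<lambda>_. 0) = (\<lambda>_. 0)"
  using koszul_d_diff[of vs "\<lambda>_. 0" "\<lambda>_. 0"] by simp

lemma koszul_d_uminus: "koszul_d x vs (\<lambda>bs. - f bs) = (\<lambda>bs. - koszul_d x vs f bs)"
  using koszul_d_diff[of vs "\<lambda>_. 0" f] by simp

lemma koszul_d_add: "koszul_d x vs (\<lambda>bs. f bs + g bs) = (\<lambda>bs. koszul_d x vs f bs + koszul_d x vs g bs)"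
  using koszul_d_diff[of vs f "\<lambda>bs. - g bs"] by (simp add: koszul_d_uminus)

lemma koszul_d_x: "koszul_d x vs (\<lambda>bs. x v (f bs)) = (\<lambda>bs. x v (koszul_d x vs f bs))"
proof (induction vs arbitrary: f)
  case (Cons w vs)
  show ?case
    by (auto simp: Cons x_diff fun_eq_iff join_def x_comm[of v w] split: list.splits)
qed simp

text \<open>The second component of d(d(f, g)) is w df - d(w f - dg). It vanishes because d commutes
  with \<open>x w\<close>, and this cancellation dictates the sign in the cone.\<close>

lemma koszul_d_kd: "koszul_d x vs (koszul_d x vs f) = (\<lambda>_. 0)"
proof (induction vs arbitrary: f)
  case (Cons w vs)
  show ?case
    by (auto simp: Cons koszul_d_diff koszul_d_x fun_eq_iff join_def split: list.splits)
qed simp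

lemma cochains_diff:
  "f \<in> cochains n p r N \<Longrightarrow> g \<in> cochains n p r N \<Longrightarrow> (\<lambda>bs. f bs - g bs) \<in> cochains n p r N"
  unfolding cochains_def mem_Collect_eq by (metis diff_zero diff_0 diff_mem neg_eq_iff_add_eq_0 add.right_neutral)

lemma cochains_zero: "(\<lambda>_. 0) \<in> cochains n p r N"
  by (simp add: cochains_def zero_mem)

lemma cochains_uminus: "f \<in> cochains n p r N \<Longrightarrow> (\<lambda>bs. - f bs) \<in> cochains n p r N"
  unfolding cochains_def by (auto simp: uminus_mem)

lemma cochains_add:
  "f \<in> cochains n p r N \<Longrightarrow> g \<in> cochains n p r N \<Longrightarrow> (\<lambda>bs. f bs + g bs) \<in> cochains n p r N"
  unfolding cochains_def mem_Collect_eq by (metis add.right_neutral add_mem)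

lemma cochains_x: "f \<in> cochains n p r N \<Longrightarrow> (\<lambda>bs. x v (f bs)) \<in> cochains n p (r + 1) N"
  unfolding cochains_def mem_Collect_eq
  by (metis add.assoc add.commute x_mem x_zero)

lemma koszul_d_mem:
  "f \<in> cochains (length vs) p r N \<Longrightarrow> koszul_d x vs f \<in> cochains (length vs) (p + 1) r N"
proof (induction vs arbitrary: f p r)
  case (Cons w vs)
  from Cons.prems obtain g h where gh: "f = join g h"
      "g \<in> cochains (length vs) p r N" "h \<in> cochains (length vs) (p - 1) (r + 1) N"
    using zero_mem by (auto elim: cochains_SucE)
  show ?case
    using gh Cons.IH[OF gh(2)] Cons.IH[OF gh(3)] cochains_diff cochains_x[OF gh(2)]
    by (auto simp: join_in_cochains_iff zero_mem)
qed (simp add: cochains_zero)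

text \<open>The differential of a cochain at position 0 has the products \<open>x v e\<close> as its
  entries.\<close>

lemma koszul_d_bottom: "koszul_d x vs (bottom (length vs) e) = (\<lambda>_. 0) \<longleftrightarrow> (\<forall>v\<in>set vs. x v e = 0)"
proof (induction vs)
  case (Cons w vs)
  have "(\<lambda>bs. x w (bottom (length vs) e bs)) = bottom (length vs) (x w e)"
    by (auto simp: bottom_def)
  moreover have "(\<lambda>_. 0) = bottom (length vs) 0" by (auto simp: bottom_def)
  ultimately have "(\<lambda>bs. x w (bottom (length vs) e bs)) = (\<lambda>_. 0) \<longleftrightarrow> x w e = 0"
    by (metis bottom_inj)
  then show ?case
    unfolding length_Cons bottom_Suc koszul_d_join join_eq_zero_iff by (auto simp: Cons)
qed simp

lemma var_multiples_ConsI: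
  "e = x w a + b \<Longrightarrow> a \<in> N (d - 1) \<Longrightarrow> b \<in> var_multiples x N vs d \<Longrightarrow>
   e \<in> var_multiples x N (w # vs) d"
  by auto

lemma var_multiples_diff:
  "a \<in> var_multiples x N vs d \<Longrightarrow> b \<in> var_multiples x N vs d \<Longrightarrow> a - b \<in> var_multiples x N vs d"
proof (induction vs arbitrary: a b)
  case (Cons w vs)
  then obtain a1 a2 b1 b2 where *: "a = x w a1 + a2" "a1 \<in> N (d - 1)" "a2 \<in> var_multiples x N vs d"
     "b = x w b1 + b2" "b1 \<in> N (d - 1)" "b2 \<in> var_multiples x N vs d"
    by auto
  then have "a - b = x w (a1 - b1) + (a2 - b2)" by (simp add: x_diff)
  then show ?case using Cons.IH[of a2 b2] * diff_mem by (intro var_multiples_ConsI)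
qed simp

lemma var_multiples_zero: "0 \<in> var_multiples x N vs d"
  by (induction vs) (simp, metis var_multiples_ConsI add_0 x_zero zero_mem)

lemma var_multiples_add:
  "a \<in> var_multiples x N vs d \<Longrightarrow> b \<in> var_multiples x N vs d \<Longrightarrow> a + b \<in> var_multiples x N vs d"
  using var_multiples_diff var_multiples_zero by (metis diff_0 diff_minus_eq_add)

lemma x_in_var_multiples: "v \<in> set vs \<Longrightarrow> a \<in> N (d - 1) \<Longrightarrow> x v a \<in> var_multiples x N vs d"
proof (induction vs)
  case (Cons w vs)
  show ?case
  proof (cases "v = w")
    case True
    then have "x v a = x w a + 0" by simp
    then show ?thesis using var_multiples_zero Cons.prems(2) by (intro var_multiples_ConsI)
  next
    case False
    then have "x v a \<in> var_multiples x N vs d" using Cons by simp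
    moreover have "x v a = x w 0 + x v a" by simp
    ultimately show ?thesis using zero_mem by (intro var_multiples_ConsI)
  qed
qed simp

text \<open>Into the top position the differential is a signed sum of multiplications by the
  variables, and signs do not matter in a subgroup. The internal degree
  \<open>d - int (length vs)\<close> is the one for which the top value has degree
  \<open>d\<close>.\<close>

lemma top_cell_boundary_iff:
  "(\<exists>g\<in>cochains (length vs) (int (length vs) - 1) (d - int (length vs)) N.
      koszul_d x vs g = top_cell (length vs) e) \<longleftrightarrow> e \<in> var_multiples x N vs d"
proof (induction vs arbitrary: e)
  case Nil
  have "(\<lambda>_. 0) = top_cell 0 0" by (auto simp: top_cell_def)
  then have "(\<lambda>_. 0) = top_cell 0 e \<longleftrightarrow> e = 0" by (metis top_cell_inj)
  then show ?case using cochains_zero by auto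
next
  case (Cons w vs)
  let ?n = "length vs"
  show ?case
  proof
    assume "\<exists>g\<in>cochains (length (w # vs)) (int (length (w # vs)) - 1) (d - int (length (w # vs))) N.
      koszul_d x (w # vs) g = top_cell (length (w # vs)) e"
    then obtain g where g: "g \<in> cochains (Suc ?n) (int ?n) (d - int ?n - 1) N"
        "koszul_d x (w # vs) g = top_cell (Suc ?n) e"
      by (auto simp: algebra_simps)
    obtain g0 g1 where g01: "g = join g0 g1" "g0 \<in> cochains ?n (int ?n) (d - int ?n - 1) N"
        "g1 \<in> cochains ?n (int ?n - 1) (d - int ?n) N"
      using cochains_SucE[OF g(1)] zero_mem by (metis diff_add_cancel)
    obtain a where a: "a \<in> N (d - 1)" "g0 = top_cell ?n a"
      using cochains_topE[OF g01(2)] by (metis add_diff_cancel_left' diff_add_cancel diff_right_commute)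
    have "(\<lambda>bs. x w (g0 bs) - koszul_d x vs g1 bs) = top_cell ?n e"
      using g(2) unfolding g01(1) koszul_d_join top_cell_Suc join_cong_iff by simp
    then have "x w (g0 bs) - koszul_d x vs g1 bs = top_cell ?n e bs" for bs by metis
    then have "koszul_d x vs g1 bs = top_cell ?n (x w a - e) bs" for bs
      unfolding a(2) top_cell_def
      by (smt (verit, ccfv_threshold) add_diff_cancel_left' diff_add_cancel diff_self x_zero)
    then have "koszul_d x vs g1 = top_cell ?n (x w a - e)" by auto
    then have "x w a - e \<in> var_multiples x N vs d" using g01(3) Cons by blast
    then have "0 - (x w a - e) \<in> var_multiples x N vs d"
      using var_multiples_diff var_multiples_zero by blast
    moreover have "e = x w a + (0 - (x w a - e))" by simp
    ultimately show "e \<in> var_multiples x N (w # vs) d" using a(1) by (intro var_multiples_ConsI)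
  next
    assume "e \<in> var_multiples x N (w # vs) d"
    then obtain a b where ab: "e = x w a + b" "a \<in> N (d - 1)" "b \<in> var_multiples x N vs d"
      by auto
    then have "0 - b \<in> var_multiples x N vs d"
      using var_multiples_diff var_multiples_zero by blast
    then obtain g1 where g1: "g1 \<in> cochains ?n (int ?n - 1) (d - int ?n) N"
        "koszul_d x vs g1 = top_cell ?n (- b)"
      using Cons by auto
    have top: "top_cell ?n a \<in> cochains ?n (int ?n) (d - int ?n - 1) N"
      using ab(2) by (intro top_cell_in_cochains zero_mem) (simp add: algebra_simps)
    have "koszul_d x vs (top_cell ?n a) = (\<lambda>_. 0)"
      using koszul_d_mem[OF top] by (intro cochains_trivial) auto
    moreover have "(\<lambda>bs. x w (top_cell ?n a bs) - koszul_d x vs g1 bs) = top_cell ?n e"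
      unfolding g1(2) using ab(1) by (auto simp: top_cell_def)
    ultimately have "koszul_d x (w # vs) (join (top_cell ?n a) g1) = top_cell (length (w # vs)) e"
      unfolding length_Cons top_cell_Suc koszul_d_join by simp
    moreover have "join (top_cell ?n a) g1 \<in>
        cochains (length (w # vs)) (int (length (w # vs)) - 1) (d - int (length (w # vs))) N"
      using top g1(1) by (simp add: join_in_cochains_iff zero_mem algebra_simps)
    ultimately show "\<exists>g\<in>cochains (length (w # vs)) (int (length (w # vs)) - 1)
        (d - int (length (w # vs))) N. koszul_d x (w # vs) g = top_cell (length (w # vs)) e"
      by blast
  qed
qed

text \<open>Every cochain at the top position is a cocycle, so the top cohomology is N / (vs)
  N.\<close>

lemma koszul_acyclic_top_iff:
  "koszul_acyclic x N vs (int (length vs)) r \<longleftrightarrow>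
     N (r + int (length vs)) \<subseteq> var_multiples x N vs (r + int (length vs))"
proof -
  let ?n = "length vs"
  have kd0: "koszul_d x vs f = (\<lambda>_. 0)" if "f \<in> cochains ?n (int ?n) r N" for f
    using koszul_d_mem[OF that] by (intro cochains_trivial) auto
  have "koszul_acyclic x N vs (int ?n) r \<longleftrightarrow>
     (\<forall>e\<in>N (r + int ?n). \<exists>g\<in>cochains ?n (int ?n - 1) r N. koszul_d x vs g = top_cell ?n e)"
    (is "?L \<longleftrightarrow> ?R")
  proof
    assume ?L
    then show ?R unfolding koszul_acyclic_def
      using top_cell_in_cochains[of N _ r ?n, OF zero_mem] kd0 by blast
  next
    assume R: ?R
    show ?L unfolding koszul_acyclic_def
    proof (intro ballI impI)
      fix f assume "f \<in> cochains ?n (int ?n) r N"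
      then obtain e where "e \<in> N (r + int ?n)" "f = top_cell ?n e" by (rule cochains_topE)
      then show "\<exists>g\<in>cochains ?n (int ?n - 1) r N. koszul_d x vs g = f" using R by blast
    qed
  qed
  also have "\<dots> \<longleftrightarrow> N (r + int ?n) \<subseteq> var_multiples x N vs (r + int ?n)"
    using top_cell_boundary_iff[of vs "r + int ?n"] by auto
  finally show ?thesis .
qed

text \<open>A primitive in the cone has the form (h, -k): its differential is (dh, w h + dk). So
  besides a primitive \<open>h\<close> of \<open>f\<close>, a primitive \<open>k\<close> of g - w h
  is required.\<close>

lemma koszul_acyclic_Cons:
  assumes f: "f \<in> cochains (length vs) p r N" and g: "g \<in> cochains (length vs) (p - 1) (r + 1) N"
    and cocycle: "koszul_d x (w # vs) (join f g) = (\<lambda>_. 0)"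
    and h: "h \<in> cochains (length vs) (p - 1) r N" "koszul_d x vs h = f"
    and "(\<lambda>bs. g bs - x w (h bs)) = koszul_d x vs k" "k \<in> cochains (length vs) (p - 2) (r + 1) N"
  shows "\<exists>g'\<in>cochains (length (w # vs)) (p - 1) r N. koszul_d x (w # vs) g' = join f g"
proof
  have "- (koszul_d x vs k bs) = x w (h bs) - g bs" for bs
    using assms(6) by (metis minus_diff_eq)
  then have "x w (h bs) - koszul_d x vs (\<lambda>bs. - k bs) bs = g bs" for bs
    unfolding koszul_d_uminus using fun_cong[OF assms(6), of bs] by (simp add: algebra_simps)
  then show "koszul_d x (w # vs) (join h (\<lambda>bs. - k bs)) = join f g"
    unfolding koszul_d_join h(2) by simp
  show "join h (\<lambda>bs. - k bs) \<in> cochains (length (w # vs)) (p - 1) r N"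
    using h(1) cochains_uminus[OF assms(7)] by (simp add: join_in_cochains_iff zero_mem)
qed

text \<open>Given a primitive \<open>h\<close> of \<open>f\<close>, the difference g - w h is a
  cocycle at position \<open>p - 1\<close>. The induction hypothesis gives it a primitive unless p =
  1; there it is an element killed by \<open>vs\<close>, and coregularity divides it by
  \<open>w\<close>.\<close>

lemma koszul_acyclic_coregular:
  assumes "coregular x N vs" "p > 0"
  shows "koszul_acyclic x N vs p r"
  using assms
proof (induction vs arbitrary: p r)
  case (Nil p r)
  then show ?case unfolding koszul_acyclic_def
    using cochains_trivial[of _ 0 p r N] cochains_zero by (metis koszul_d.simps(1) list.size(3) of_nat_0)
next
  case (Cons w vs p r)
  let ?n = "length vs"
  show ?case unfolding koszul_acyclic_def
  proof (intro ballI impI)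
    fix F assume F: "F \<in> cochains (length (w # vs)) p r N" "koszul_d x (w # vs) F = (\<lambda>_. 0)"
    obtain f g where fg: "F = join f g" "f \<in> cochains ?n p r N" "g \<in> cochains ?n (p - 1) (r + 1) N"
      using F(1) zero_mem unfolding length_Cons by (rule cochains_SucE)
    have "koszul_d x vs f = (\<lambda>_. 0)" and xf: "(\<lambda>bs. x w (f bs) - koszul_d x vs g bs) = (\<lambda>_. 0)"
      using F(2) unfolding fg(1) koszul_d_join join_eq_zero_iff by blast+
    then obtain h where h: "h \<in> cochains ?n (p - 1) r N" "koszul_d x vs h = f"
      using Cons.IH[of p r] Cons.prems fg(2) unfolding koszul_acyclic_def by auto
    have gx: "(\<lambda>bs. g bs - x w (h bs)) \<in> cochains ?n (p - 1) (r + 1) N"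
      using cochains_diff cochains_x h(1) fg(3) by blast
    have kdg: "koszul_d x vs (\<lambda>bs. g bs - x w (h bs)) = (\<lambda>_. 0)"
      unfolding koszul_d_diff koszul_d_x h(2) using xf by (auto simp: fun_eq_iff)
    show "\<exists>g\<in>cochains (length (w # vs)) (p - 1) r N. koszul_d x (w # vs) g = F"
    proof (cases "p = 1")
      case False
      then obtain k where "k \<in> cochains ?n (p - 1 - 1) (r + 1) N"
          "koszul_d x vs k = (\<lambda>bs. g bs - x w (h bs))"
        using Cons.IH[of "p - 1" "r + 1"] Cons.prems gx kdg unfolding koszul_acyclic_def by auto
      then show ?thesis using koszul_acyclic_Cons[OF fg(2,3) _ h, of w k] F(2) fg(1) by simp
    next
      case True
      obtain e where e: "e \<in> N (r + 1)" "(\<lambda>bs. g bs - x w (h bs)) = bottom ?n e"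
        using gx[unfolded True diff_self] by (rule cochains_0E)
      then have "\<forall>v\<in>set vs. x v e = 0" using kdg koszul_d_bottom by simp
      then obtain e' where e': "e' \<in> N r" "x w e' = e" "\<forall>v\<in>set vs. x v e' = 0"
        using Cons.prems e(1) by (auto; metis add_diff_cancel_right')
      \<comment> \<open>Since \<open>e'\<close> is killed by \<open>vs\<close>, adding it to
        \<open>h\<close> keeps the differential \<open>f\<close>; since w e' = e, it turns the
        obstruction g - w h into 0.\<close>
      let ?h = "\<lambda>bs. h bs + bottom ?n e' bs"
      have h': "?h \<in> cochains ?n (p - 1) r N" "koszul_d x vs ?h = f"
        using h True bottom_in_cochains[of N e' r ?n] zero_mem e' cochains_add
        by (auto simp: koszul_d_add iffD2[OF koszul_d_bottom])
      have "(\<lambda>bs. g bs - x w (?h bs)) = koszul_d x vs (\<lambda>_. 0)"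
      proof
        fix bs
        have "g bs - x w (?h bs) = bottom ?n e bs - x w (bottom ?n e' bs)"
          using fun_cong[OF e(2), of bs] by (simp add: x_add algebra_simps)
        then show "g bs - x w (?h bs) = koszul_d x vs (\<lambda>_. 0) bs"
          using e'(2) by (auto simp: bottom_def)
      qed
      then show ?thesis
        using koszul_acyclic_Cons[OF fg(2,3) _ h' _ cochains_zero, of w] F(2) fg(1) by simp
    qed
  qed
qed

text \<open>The induction hypothesis fails to give a primitive of \<open>f\<close> only when
  \<open>f\<close> sits at the top position for \<open>vs\<close>, hence is a single element
  \<open>e\<close>. The cocycle condition then says that w e is a boundary, so a multiple of
  \<open>vs\<close>, and regularity makes \<open>e\<close> itself one.\<close>

lemma koszul_acyclic_regular:
  assumes "regular x N vs" "p < int (length vs)"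
  shows "koszul_acyclic x N vs p r"
  using assms
proof (induction vs arbitrary: p r)
  case (Nil p r)
  then show ?case unfolding koszul_acyclic_def
    using cochains_trivial[of _ 0 p r N] cochains_zero by (metis koszul_d.simps(1) list.size(3) of_nat_0)
next
  case (Cons w vs p r)
  let ?n = "length vs"
  show ?case unfolding koszul_acyclic_def
  proof (intro ballI impI)
    fix F assume F: "F \<in> cochains (length (w # vs)) p r N" "koszul_d x (w # vs) F = (\<lambda>_. 0)"
    obtain f g where fg: "F = join f g" "f \<in> cochains ?n p r N" "g \<in> cochains ?n (p - 1) (r + 1) N"
      using F(1) zero_mem unfolding length_Cons by (rule cochains_SucE)
    have kdf: "koszul_d x vs f = (\<lambda>_. 0)" and xf: "(\<lambda>bs. x w (f bs) - koszul_d x vs g bs) = (\<lambda>_. 0)"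
      using F(2) unfolding fg(1) koszul_d_join join_eq_zero_iff by blast+
    have "\<exists>h\<in>cochains ?n (p - 1) r N. koszul_d x vs h = f"
    proof (cases "p = int ?n")
      case False
      then show ?thesis using Cons.IH[of p r] Cons.prems fg(2) kdf unfolding koszul_acyclic_def by auto
    next
      case True
      obtain e where e: "e \<in> N (r + int ?n)" "f = top_cell ?n e"
        using fg(2)[unfolded True] by (rule cochains_topE)
      have "koszul_d x vs g bs = x w (f bs)" for bs
        using fun_cong[OF xf, of bs] by simp
      then have "koszul_d x vs g = top_cell ?n (x w e)"
        unfolding e(2) by (auto simp: top_cell_def)
      then have "x w e \<in> var_multiples x N vs (r + int ?n + 1)"
        using top_cell_boundary_iff[of vs "r + int ?n + 1" "x w e"] fg(3) True
        by (auto simp: algebra_simps)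
      then have "e \<in> var_multiples x N vs (r + int ?n)"
        using Cons.prems e(1) by auto
      then show ?thesis
        using top_cell_boundary_iff[of vs "r + int ?n" e] True e(2) by auto
    qed
    then obtain h where h: "h \<in> cochains ?n (p - 1) r N" "koszul_d x vs h = f" by blast
    have gx: "(\<lambda>bs. g bs - x w (h bs)) \<in> cochains ?n (p - 1) (r + 1) N"
      using cochains_diff cochains_x h(1) fg(3) by blast
    have kdg: "koszul_d x vs (\<lambda>bs. g bs - x w (h bs)) = (\<lambda>_. 0)"
      unfolding koszul_d_diff koszul_d_x h(2) using xf by (auto simp: fun_eq_iff)
    obtain k where "k \<in> cochains ?n (p - 1 - 1) (r + 1) N"
        "koszul_d x vs k = (\<lambda>bs. g bs - x w (h bs))"
      using Cons.IH[of "p - 1" "r + 1"] Cons.prems gx kdg unfolding koszul_acyclic_def by auto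
    then show "\<exists>g\<in>cochains (length (w # vs)) (p - 1) r N. koszul_d x (w # vs) g = F"
      using koszul_acyclic_Cons[OF fg(2,3) _ h, of w k] F(2) fg(1) by simp
  qed
qed

lemma koszul_acyclic_0_iff:
  "koszul_acyclic x N vs 0 r \<longleftrightarrow> (\<forall>e\<in>N r. (\<forall>v\<in>set vs. x v e = 0) \<longrightarrow> e = 0)"
proof
  assume L: "koszul_acyclic x N vs 0 r"
  show "\<forall>e\<in>N r. (\<forall>v\<in>set vs. x v e = 0) \<longrightarrow> e = 0"
  proof (intro ballI impI)
    fix e assume "e \<in> N r" "\<forall>v\<in>set vs. x v e = 0"
    then obtain g where "g \<in> cochains (length vs) (0 - 1) r N" "koszul_d x vs g = bottom (length vs) e"
      using L bottom_in_cochains[of N e r "length vs", OF zero_mem] koszul_d_bottom unfolding koszul_acyclic_def by blast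
    then have "bottom (length vs) e = (\<lambda>_. 0)"
      using cochains_trivial[of g "length vs" "0 - 1" r N] by simp
    then show "e = 0" by (metis bottom_def)
  qed
next
  assume R: "\<forall>e\<in>N r. (\<forall>v\<in>set vs. x v e = 0) \<longrightarrow> e = 0"
  show "koszul_acyclic x N vs 0 r" unfolding koszul_acyclic_def
  proof (intro ballI impI)
    fix f assume f: "f \<in> cochains (length vs) 0 r N" "koszul_d x vs f = (\<lambda>_. 0)"
    obtain e where e: "e \<in> N r" "f = bottom (length vs) e" using f(1) by (rule cochains_0E)
    then have "e = 0" using R f(2) koszul_d_bottom by simp
    then have "f = koszul_d x vs (\<lambda>_. 0)" using e(2) by (auto simp: bottom_def)
    then show "\<exists>g\<in>cochains (length vs) (0 - 1) r N. koszul_d x vs g = f" using cochains_zero by blast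
  qed
qed

lemma koszul_acyclic_outside: "p < 0 \<or> p > int (length vs) \<Longrightarrow> koszul_acyclic x N vs p r"
  unfolding koszul_acyclic_def
proof (intro ballI impI)
  fix f assume "p < 0 \<or> p > int (length vs)" "f \<in> cochains (length vs) p r N"
  then have "koszul_d x vs (\<lambda>_. 0) = f" using cochains_trivial[of f "length vs" p r N] by simp
  then show "\<exists>g\<in>cochains (length vs) (p - 1) r N. koszul_d x vs g = f" using cochains_zero by blast
qed

end

section \<open>Long exact sequences\<close>

text \<open>\<open>Q\<close> is meant to be the image of the map, so that each map of a resolution
  gives a short exact sequence of \<open>ker\<close>, \<open>N\<close> and \<open>Q\<close>.
  Compatibility is asked on homogeneous elements only, as homomorphisms are not controlled off the
  carrier.\<close>

locale koszul_surj = dom: koszul_module x N + cod: koszul_module y Q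
  for x :: "'n \<Rightarrow> 'a::ab_group_add \<Rightarrow> 'a" and N :: "int \<Rightarrow> 'a set"
    and y :: "'n \<Rightarrow> 'b::ab_group_add \<Rightarrow> 'b" and Q :: "int \<Rightarrow> 'b set" +
  fixes \<phi> :: "'a \<Rightarrow> 'b"
  assumes \<phi>_add: "a \<in> N d \<Longrightarrow> b \<in> N d \<Longrightarrow> \<phi> (a + b) = \<phi> a + \<phi> b"
    and \<phi>_x: "a \<in> N d \<Longrightarrow> \<phi> (x v a) = y v (\<phi> a)"
    and \<phi>_image: "\<phi> ` N d = Q d"
begin

lemma \<phi>_zero [simp]: "\<phi> 0 = 0"
  using \<phi>_add[OF dom.zero_mem dom.zero_mem] by simp

lemma \<phi>_diff: "a \<in> N d \<Longrightarrow> b \<in> N d \<Longrightarrow> \<phi> (a - b) = \<phi> a - \<phi> b"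
  using \<phi>_add[OF dom.diff_mem[of a d b], of b] by (simp add: algebra_simps)

definition ker :: "int \<Rightarrow> 'a set" where
  "ker d = {a \<in> N d. \<phi> a = 0}"

sublocale ker: koszul_module x ker
proof
  fix a b d v
  show "a \<in> ker d \<Longrightarrow> b \<in> ker d \<Longrightarrow> a - b \<in> ker d"
    using dom.diff_mem \<phi>_diff by (auto simp: ker_def)
  show "a \<in> ker d \<Longrightarrow> x v a \<in> ker (d + 1)"
    using dom.x_mem \<phi>_x by (auto simp: ker_def)
qed (auto simp: ker_def dom.zero_mem dom.x_add dom.x_comm)

lemma cochains_mem: "f \<in> cochains n p r N \<Longrightarrow> f bs \<in> N (r + ones bs)"
  by (simp add: cochains_def)

lemma \<phi>_cochains: "f \<in> cochains n p r N \<Longrightarrow> (\<lambda>bs. \<phi> (f bs)) \<in> cochains n p r Q"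
  unfolding cochains_def using \<phi>_image by force

lemma koszul_d_\<phi>:
  "f \<in> cochains (length vs) p r N \<Longrightarrow> koszul_d y vs (\<lambda>bs. \<phi> (f bs)) = (\<lambda>bs. \<phi> (koszul_d x vs f bs))"
proof (induction vs arbitrary: f p r)
  case (Cons w vs)
  obtain g h where gh: "f = join g h" "g \<in> cochains (length vs) p r N"
      "h \<in> cochains (length vs) (p - 1) (r + 1) N"
    using Cons.prems dom.zero_mem unfolding length_Cons by (rule cochains_SucE)
  have "\<phi> (x w (g bs) - koszul_d x vs h bs) = y w (\<phi> (g bs)) - \<phi> (koszul_d x vs h bs)" for bs
    using \<phi>_diff[OF cochains_mem[OF dom.cochains_x[OF gh(2), of w], of bs]]
      cochains_mem[OF dom.koszul_d_mem[OF gh(3)], of bs] \<phi>_x[OF cochains_mem[OF gh(2), of bs]]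
    by simp
  then show ?case
    unfolding gh(1) by (auto simp: Cons.IH[OF gh(2)] Cons.IH[OF gh(3)] fun_eq_iff join_def split: list.splits)
qed simp

lemma cochains_lift:
  assumes "f \<in> cochains n p r Q"
  obtains g where "g \<in> cochains n p r N" "(\<lambda>bs. \<phi> (g bs)) = f"
proof -
  \<comment> \<open>Lifting 0 to 0 keeps the support within the indices of position
    \<open>p\<close>.\<close>
  have "\<exists>a. a \<in> N (r + ones bs) \<and> \<phi> a = f bs \<and> (f bs = 0 \<longrightarrow> a = 0)" for bs
  proof (cases "f bs = 0")
    case False
    then show ?thesis using assms \<phi>_image by (auto simp: cochains_def) (metis imageE)
  qed (use dom.zero_mem in auto)
  then obtain g where g: "\<And>bs. g bs \<in> N (r + ones bs) \<and> \<phi> (g bs) = f bs \<and> (f bs = 0 \<longrightarrow> g bs = 0)"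
    by metis
  then have "g \<in> cochains n p r N"
    using assms by (auto simp: cochains_def)
  then show thesis using that g by blast
qed

lemma cochains_ker_iff:
  "f \<in> cochains n p r ker \<longleftrightarrow> f \<in> cochains n p r N \<and> (\<lambda>bs. \<phi> (f bs)) = (\<lambda>_. 0)"
  by (auto simp: cochains_def ker_def fun_eq_iff)

text \<open>The part \<open>H\<^sup>p(N) \<rightarrow> H\<^sup>p(Q) \<rightarrow> H\<^sup>p\<^sup>+\<^sup>1(ker) \<rightarrow> H\<^sup>p\<^sup>+\<^sup>1(N)\<close> of the long exact sequence, in the case
  where the last map vanishes.\<close>

lemma koszul_acyclic_ker_iff:
  assumes null: "\<And>f. f \<in> cochains (length vs) (p + 1) r ker \<Longrightarrow> koszul_d x vs f = (\<lambda>_. 0) \<Longrightarrow>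
      \<exists>g\<in>cochains (length vs) p r N. koszul_d x vs g = f"
  shows "koszul_acyclic x ker vs (p + 1) r \<longleftrightarrow>
    (\<forall>f\<in>cochains (length vs) p r Q. koszul_d y vs f = (\<lambda>_. 0) \<longrightarrow>
       (\<exists>g\<in>cochains (length vs) p r N. \<exists>h\<in>cochains (length vs) (p - 1) r Q.
          koszul_d x vs g = (\<lambda>_. 0) \<and> f = (\<lambda>bs. \<phi> (g bs) + koszul_d y vs h bs)))"
  (is "?L \<longleftrightarrow> ?R")
proof
  assume ?L
  show ?R
  proof (intro ballI impI)
    fix f assume f: "f \<in> cochains (length vs) p r Q" "koszul_d y vs f = (\<lambda>_. 0)"
    obtain g where g: "g \<in> cochains (length vs) p r N" "(\<lambda>bs. \<phi> (g bs)) = f"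
      using f(1) by (rule cochains_lift)
    \<comment> \<open>This cocycle represents the image of \<open>f\<close> under the connecting
      map; a primitive of it in the kernel corrects the lift \<open>g\<close> to a cocycle.\<close>
    have "koszul_d x vs g \<in> cochains (length vs) (p + 1) r ker"
      using g f(2) koszul_d_\<phi>[OF g(1)] dom.koszul_d_mem[OF g(1)] by (simp add: cochains_ker_iff)
    then obtain k where k: "k \<in> cochains (length vs) p r ker" "koszul_d x vs k = koszul_d x vs g"
      using \<open>?L\<close> dom.koszul_d_kd unfolding koszul_acyclic_def by (metis add_diff_cancel_right')
    let ?g = "\<lambda>bs. g bs - k bs"
    have kN: "k \<in> cochains (length vs) p r N" "(\<lambda>bs. \<phi> (k bs)) = (\<lambda>_. 0)"
      using k(1) cochains_ker_iff by auto
    have "\<phi> (?g bs) = f bs" for bs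
      using \<phi>_diff[OF cochains_mem[OF g(1)] cochains_mem[OF kN(1)], of bs]
        fun_cong[OF g(2), of bs] fun_cong[OF kN(2), of bs] by simp
    then have "f = (\<lambda>bs. \<phi> (?g bs) + koszul_d y vs (\<lambda>_. 0) bs)" by auto
    moreover have "koszul_d x vs ?g = (\<lambda>_. 0)" by (simp add: dom.koszul_d_diff k(2))
    ultimately show "\<exists>g\<in>cochains (length vs) p r N. \<exists>h\<in>cochains (length vs) (p - 1) r Q.
          koszul_d x vs g = (\<lambda>_. 0) \<and> f = (\<lambda>bs. \<phi> (g bs) + koszul_d y vs h bs)"
      using dom.cochains_diff[OF g(1) kN(1)] cod.cochains_zero by blast
  qed
next
  assume R: ?R
  show ?L unfolding koszul_acyclic_def
  proof (intro ballI impI)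
    fix f assume f: "f \<in> cochains (length vs) (p + 1) r ker" "koszul_d x vs f = (\<lambda>_. 0)"
    then obtain g where g: "g \<in> cochains (length vs) p r N" "koszul_d x vs g = f"
      using null by blast
    have "koszul_d y vs (\<lambda>bs. \<phi> (g bs)) = (\<lambda>_. 0)"
      using koszul_d_\<phi>[OF g(1)] g(2) f(1) by (simp add: cochains_ker_iff)
    then obtain g' h where g': "g' \<in> cochains (length vs) p r N" "koszul_d x vs g' = (\<lambda>_. 0)"
        and h: "h \<in> cochains (length vs) (p - 1) r Q"
          "(\<lambda>bs. \<phi> (g bs)) = (\<lambda>bs. \<phi> (g' bs) + koszul_d y vs h bs)"
      using R \<phi>_cochains[OF g(1)] by meson
    obtain h' where h': "h' \<in> cochains (length vs) (p - 1) r N" "(\<lambda>bs. \<phi> (h' bs)) = h"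
      using h(1) by (rule cochains_lift)
    have kh': "koszul_d x vs h' \<in> cochains (length vs) p r N" using dom.koszul_d_mem[OF h'(1)] by simp
    \<comment> \<open>The primitive \<open>g\<close> is changed by a cocycle and a boundary of
      \<open>N\<close>: its differential remains \<open>f\<close>, and its image in \<open>Q\<close>
      becomes 0.\<close>
    let ?k = "\<lambda>bs. (g bs - g' bs) - koszul_d x vs h' bs"
    have gg': "(\<lambda>bs. g bs - g' bs) \<in> cochains (length vs) p r N"
      using dom.cochains_diff g(1) g'(1) by blast
    have "\<phi> (?k bs) = 0" for bs
      using \<phi>_diff[OF cochains_mem[OF gg'] cochains_mem[OF kh'], of bs]
        \<phi>_diff[OF cochains_mem[OF g(1)] cochains_mem[OF g'(1)], of bs]
        fun_cong[OF h(2), of bs] fun_cong[OF koszul_d_\<phi>[OF h'(1)], of bs] h'(2)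
      by simp
    then have "?k \<in> cochains (length vs) p r ker"
      using dom.cochains_diff[OF gg' kh'] by (simp add: cochains_ker_iff)
    moreover have "koszul_d x vs ?k = f"
      by (simp add: dom.koszul_d_diff dom.koszul_d_kd g(2) g'(2))
    ultimately show "\<exists>g\<in>cochains (length vs) (p + 1 - 1) r ker. koszul_d x vs g = f"
      by (metis add_diff_cancel_right')
  qed
qed

text \<open>With H^p(N) = 0 the connecting map H^p(Q) -> H^(p+1)(ker) is bijective. The first
  assumption asks that H^(p+1)(ker) -> H^(p+1)(N) be zero rather than that its target vanish,
  because the top cohomology of a free module is nonzero in general.\<close>

lemma koszul_acyclic_shift:
  assumes "\<And>f. f \<in> cochains (length vs) (p + 1) r ker \<Longrightarrow> koszul_d x vs f = (\<lambda>_. 0) \<Longrightarrow>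
      \<exists>g\<in>cochains (length vs) p r N. koszul_d x vs g = f"
    and "koszul_acyclic x N vs p r"
  shows "koszul_acyclic x ker vs (p + 1) r \<longleftrightarrow> koszul_acyclic y Q vs p r"
proof -
  have "(\<exists>g\<in>cochains (length vs) p r N. \<exists>h\<in>cochains (length vs) (p - 1) r Q.
          koszul_d x vs g = (\<lambda>_. 0) \<and> f = (\<lambda>bs. \<phi> (g bs) + koszul_d y vs h bs)) \<longleftrightarrow>
        (\<exists>h\<in>cochains (length vs) (p - 1) r Q. koszul_d y vs h = f)"
    if "f \<in> cochains (length vs) p r Q" for f
  proof
    assume "\<exists>g\<in>cochains (length vs) p r N. \<exists>h\<in>cochains (length vs) (p - 1) r Q.
          koszul_d x vs g = (\<lambda>_. 0) \<and> f = (\<lambda>bs. \<phi> (g bs) + koszul_d y vs h bs)"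
    then obtain g h where g: "g \<in> cochains (length vs) p r N" "koszul_d x vs g = (\<lambda>_. 0)"
        and h: "h \<in> cochains (length vs) (p - 1) r Q" "f = (\<lambda>bs. \<phi> (g bs) + koszul_d y vs h bs)"
      by blast
    obtain k where k: "k \<in> cochains (length vs) (p - 1) r N" "koszul_d x vs k = g"
      using assms(2) g unfolding koszul_acyclic_def by blast
    have "koszul_d y vs (\<lambda>bs. \<phi> (k bs) + h bs) = f"
      unfolding cod.koszul_d_add koszul_d_\<phi>[OF k(1)] k(2) h(2) ..
    then show "\<exists>h\<in>cochains (length vs) (p - 1) r Q. koszul_d y vs h = f"
      using cod.cochains_add[OF \<phi>_cochains[OF k(1)] h(1)] by blast
  next
    assume "\<exists>h\<in>cochains (length vs) (p - 1) r Q. koszul_d y vs h = f"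
    then obtain h where h: "h \<in> cochains (length vs) (p - 1) r Q" "koszul_d y vs h = f" by blast
    have "f = (\<lambda>bs. \<phi> 0 + koszul_d y vs h bs)" using h by auto
    then show "\<exists>g\<in>cochains (length vs) p r N. \<exists>h\<in>cochains (length vs) (p - 1) r Q.
          koszul_d x vs g = (\<lambda>_. 0) \<and> f = (\<lambda>bs. \<phi> (g bs) + koszul_d y vs h bs)"
      by (intro bexI[of _ "\<lambda>_. 0"] bexI[of _ h] conjI dom.koszul_d_zero dom.cochains_zero h(1))
  qed
  note * = this
  have "koszul_acyclic x ker vs (p + 1) r \<longleftrightarrow> (\<forall>f\<in>cochains (length vs) p r Q. koszul_d y vs f = (\<lambda>_. 0) \<longrightarrow>
       (\<exists>g\<in>cochains (length vs) p r N. \<exists>h\<in>cochains (length vs) (p - 1) r Q.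
          koszul_d x vs g = (\<lambda>_. 0) \<and> f = (\<lambda>bs. \<phi> (g bs) + koszul_d y vs h bs)))"
    using assms(1) by (rule koszul_acyclic_ker_iff)
  also have "\<dots> \<longleftrightarrow> (\<forall>f\<in>cochains (length vs) p r Q. koszul_d y vs f = (\<lambda>_. 0) \<longrightarrow>
       (\<exists>h\<in>cochains (length vs) (p - 1) r Q. koszul_d y vs h = f))"
    by (intro ball_cong refl imp_cong *)
  finally show ?thesis unfolding koszul_acyclic_def[of y] .
qed

text \<open>For the coaugmentation: it identifies \<open>M\<close> with the kernel of the first
  differential, which lives in another type.\<close>

lemma koszul_acyclic_iso:
  assumes inj: "\<And>d a. a \<in> N d \<Longrightarrow> \<phi> a = 0 \<Longrightarrow> a = 0"
  shows "koszul_acyclic x N vs p r \<longleftrightarrow> koszul_acyclic y Q vs p r"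
proof
  assume L: "koszul_acyclic x N vs p r"
  show "koszul_acyclic y Q vs p r" unfolding koszul_acyclic_def
  proof (intro ballI impI)
    fix f assume f: "f \<in> cochains (length vs) p r Q" "koszul_d y vs f = (\<lambda>_. 0)"
    obtain g where g: "g \<in> cochains (length vs) p r N" "(\<lambda>bs. \<phi> (g bs)) = f"
      using f(1) by (rule cochains_lift)
    have "\<phi> (koszul_d x vs g bs) = 0" for bs
      using koszul_d_\<phi>[OF g(1)] f(2) g(2) by metis
    then have "koszul_d x vs g = (\<lambda>_. 0)"
      using inj cochains_mem[OF dom.koszul_d_mem[OF g(1)]] by blast
    then obtain k where k: "k \<in> cochains (length vs) (p - 1) r N" "koszul_d x vs k = g"
      using L g(1) unfolding koszul_acyclic_def by blast
    have "koszul_d y vs (\<lambda>bs. \<phi> (k bs)) = f"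
      unfolding koszul_d_\<phi>[OF k(1)] k(2) g(2) ..
    then show "\<exists>h\<in>cochains (length vs) (p - 1) r Q. koszul_d y vs h = f"
      using \<phi>_cochains[OF k(1)] by blast
  qed
next
  assume R: "koszul_acyclic y Q vs p r"
  show "koszul_acyclic x N vs p r" unfolding koszul_acyclic_def
  proof (intro ballI impI)
    fix f assume f: "f \<in> cochains (length vs) p r N" "koszul_d x vs f = (\<lambda>_. 0)"
    have "koszul_d y vs (\<lambda>bs. \<phi> (f bs)) = (\<lambda>_. 0)"
      using koszul_d_\<phi>[OF f(1)] f(2) by simp
    then obtain h where h: "h \<in> cochains (length vs) (p - 1) r Q" "koszul_d y vs h = (\<lambda>bs. \<phi> (f bs))"
      using R \<phi>_cochains[OF f(1)] unfolding koszul_acyclic_def by blast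
    obtain g where g: "g \<in> cochains (length vs) (p - 1) r N" "(\<lambda>bs. \<phi> (g bs)) = h"
      using h(1) by (rule cochains_lift)
    have kg: "koszul_d x vs g \<in> cochains (length vs) p r N" using dom.koszul_d_mem[OF g(1)] by simp
    have "koszul_d x vs g bs - f bs = 0" for bs
    proof (rule inj)
      show "koszul_d x vs g bs - f bs \<in> N (r + ones bs)"
        using cochains_mem[OF kg] cochains_mem[OF f(1)] dom.diff_mem by blast
      show "\<phi> (koszul_d x vs g bs - f bs) = 0"
        using \<phi>_diff[OF cochains_mem[OF kg] cochains_mem[OF f(1)], of bs]
          fun_cong[OF koszul_d_\<phi>[OF g(1)], of bs] fun_cong[OF h(2), of bs] g(2) by simp
    qed
    then have "koszul_d x vs g = f" by auto
    then show "\<exists>g\<in>cochains (length vs) (p - 1) r N. koszul_d x vs g = f" using g(1) by blast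
  qed
qed

text \<open>At position 0 there are no boundaries, so the connecting map vanishes iff elements of
  \<open>Q\<close> killed by \<open>vs\<close> lift to elements of \<open>N\<close> killed by
  \<open>vs\<close>. This is how exactness of the socle complex enters.\<close>

lemma koszul_acyclic_ker_1_iff:
  assumes "koszul_acyclic x N vs 1 r"
  shows "koszul_acyclic x ker vs 1 r \<longleftrightarrow> (\<forall>e\<in>Q r. (\<forall>v\<in>set vs. y v e = 0) \<longrightarrow>
     (\<exists>a\<in>N r. (\<forall>v\<in>set vs. x v a = 0) \<and> \<phi> a = e))" (is "_ \<longleftrightarrow> ?R")
proof -
  have "koszul_acyclic x ker vs (0 + 1) r \<longleftrightarrow> (\<forall>f\<in>cochains (length vs) 0 r Q. koszul_d y vs f = (\<lambda>_. 0) \<longrightarrow>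
       (\<exists>g\<in>cochains (length vs) 0 r N. \<exists>h\<in>cochains (length vs) (0 - 1) r Q.
          koszul_d x vs g = (\<lambda>_. 0) \<and> f = (\<lambda>bs. \<phi> (g bs) + koszul_d y vs h bs)))" (is "_ \<longleftrightarrow> ?L")
  proof (rule koszul_acyclic_ker_iff)
    fix f assume "f \<in> cochains (length vs) (0 + 1) r ker" "koszul_d x vs f = (\<lambda>_. 0)"
    then show "\<exists>g\<in>cochains (length vs) 0 r N. koszul_d x vs g = f"
      using assms cochains_ker_iff unfolding koszul_acyclic_def by fastforce
  qed
  also have "?L \<longleftrightarrow> ?R"
  proof
    assume L: ?L
    show ?R
    proof (intro ballI impI)
      fix e assume e: "e \<in> Q r" "\<forall>v\<in>set vs. y v e = 0"
      have "bottom (length vs) e \<in> cochains (length vs) 0 r Q" "koszul_d y vs (bottom (length vs) e) = (\<lambda>_. 0)"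
        using e bottom_in_cochains[of Q e r "length vs", OF cod.zero_mem] cod.koszul_d_bottom by auto
      then obtain g h where g: "g \<in> cochains (length vs) 0 r N" "koszul_d x vs g = (\<lambda>_. 0)"
          and h: "h \<in> cochains (length vs) (0 - 1) r Q"
            "bottom (length vs) e = (\<lambda>bs. \<phi> (g bs) + koszul_d y vs h bs)"
        using L by meson
      have "h = (\<lambda>_. 0)" using cochains_trivial[OF h(1)] by simp
      then have eq: "bottom (length vs) e = (\<lambda>bs. \<phi> (g bs))" using h(2) by simp
      obtain a where a: "a \<in> N r" "g = bottom (length vs) a" using g(1) by (rule cochains_0E)
      have "\<phi> a = e" using fun_cong[OF eq, of "replicate (length vs) False"] a(2) by (simp add: bottom_def)
      then show "\<exists>a\<in>N r. (\<forall>v\<in>set vs. x v a = 0) \<and> \<phi> a = e"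
        using a g(2) dom.koszul_d_bottom by auto
    qed
  next
    assume R: ?R
    show ?L
    proof (intro ballI impI)
      fix f assume f: "f \<in> cochains (length vs) 0 r Q" "koszul_d y vs f = (\<lambda>_. 0)"
      obtain e where e: "e \<in> Q r" "f = bottom (length vs) e" using f(1) by (rule cochains_0E)
      then obtain a where a: "a \<in> N r" "\<forall>v\<in>set vs. x v a = 0" "\<phi> a = e"
        using R f(2) cod.koszul_d_bottom by auto
      have "f = (\<lambda>bs. \<phi> (bottom (length vs) a bs) + koszul_d y vs (\<lambda>_. 0) bs)"
        using e(2) a(3) by (auto simp: bottom_def)
      then show "\<exists>g\<in>cochains (length vs) 0 r N. \<exists>h\<in>cochains (length vs) (0 - 1) r Q.
          koszul_d x vs g = (\<lambda>_. 0) \<and> f = (\<lambda>bs. \<phi> (g bs) + koszul_d y vs h bs)"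
        using a bottom_in_cochains[of N a r "length vs", OF dom.zero_mem] dom.koszul_d_bottom
        by (intro bexI[of _ "bottom (length vs) a"] bexI[of _ "\<lambda>_. 0"] conjI cod.cochains_zero) auto
    qed
  qed
  finally show ?thesis by simp
qed

lemma \<phi>_var_multiples:
  "e \<in> var_multiples x N vs d \<Longrightarrow> e \<in> N d \<and> \<phi> e \<in> var_multiples y Q vs d"
proof (induction vs arbitrary: e)
  case (Cons w vs)
  then obtain a b where ab: "e = x w a + b" "a \<in> N (d - 1)" "b \<in> var_multiples x N vs d"
    by auto
  have "x w a \<in> N d" using dom.x_mem[OF ab(2), of w] by simp
  moreover note Cons.IH[OF ab(3)]
  moreover have "\<phi> a \<in> Q (d - 1)" using ab(2) \<phi>_image by blast
  ultimately show ?case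
    using ab(1) \<phi>_add[of "x w a" d b] \<phi>_x[OF ab(2), of w] dom.add_mem[of "x w a" d b]
      cod.var_multiples_ConsI[of "\<phi> e" w "\<phi> a" "\<phi> b" d vs]
    by auto
qed (auto simp: dom.zero_mem)

lemma var_multiples_lift:
  "q \<in> var_multiples y Q vs d \<Longrightarrow> \<exists>e\<in>var_multiples x N vs d. \<phi> e = q"
proof (induction vs arbitrary: q)
  case (Cons w vs)
  then obtain a b where ab: "q = y w a + b" "a \<in> Q (d - 1)" "b \<in> var_multiples y Q vs d"
    by auto
  obtain a' where a': "a' \<in> N (d - 1)" "\<phi> a' = a" using ab(2) \<phi>_image by (metis imageE)
  obtain b' where b': "b' \<in> var_multiples x N vs d" "\<phi> b' = b" using Cons.IH[OF ab(3)] by blast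
  have "x w a' \<in> N d" using dom.x_mem[OF a'(1), of w] by simp
  then have "\<phi> (x w a' + b') = q"
    using \<phi>_add[of "x w a'" d b'] \<phi>_x[OF a'(1), of w] \<phi>_var_multiples[OF b'(1)] a'(2) b'(2) ab(1) by simp
  then show ?case using a'(1) b'(1) dom.var_multiples_ConsI by blast
qed auto

end

section \<open>Monomials and graded modules\<close>

definition tdeg :: "('n::finite \<Rightarrow>\<^sub>0 nat) \<Rightarrow> nat" where
  "tdeg m = (\<Sum>i\<in>UNIV. Poly_Mapping.lookup m i)"

lemma tdeg_add: "tdeg (m + m') = tdeg m + tdeg m'"
  by (simp add: tdeg_def lookup_add sum.distrib)

lemma tdeg_single [simp]: "tdeg (Poly_Mapping.single i c) = c"
  by (simp add: tdeg_def lookup_single when_def)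

lemma tdeg_zero [simp]: "tdeg 0 = 0"
  by (simp add: tdeg_def)

lemma tdeg_eq_0_iff: "tdeg m = 0 \<longleftrightarrow> m = 0"
  by (auto simp: tdeg_def poly_mapping_eq_iff fun_eq_iff)

lemma monomial_split:
  fixes m :: "'n \<Rightarrow>\<^sub>0 nat"
  assumes "Poly_Mapping.lookup m v > 0"
  shows "m = Poly_Mapping.single v 1 + (m - Poly_Mapping.single v 1)"
  by (rule poly_mapping_eqI) (use assms in \<open>auto simp: lookup_add lookup_minus lookup_single when_def\<close>)

lemma monomial_induct [case_names zero step]:
  assumes "P 0" "\<And>v m. P m \<Longrightarrow> P (Poly_Mapping.single v 1 + m)"
  shows "P (m :: 'n::finite \<Rightarrow>\<^sub>0 nat)"
proof (induction "tdeg m" arbitrary: m)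
  case 0
  then show ?case using assms(1) tdeg_eq_0_iff[of m] by simp
next
  case (Suc k)
  then obtain v where "Poly_Mapping.lookup m v > 0"
    by (metis Zero_not_Suc neq0_conv sum.neutral tdeg_def)
  note split = monomial_split[OF this]
  then have "tdeg m = 1 + tdeg (m - Poly_Mapping.single v 1)"
    by (metis tdeg_add tdeg_single)
  then show ?case using Suc split assms(2) by (metis add_left_cancel plus_1_eq_Suc)
qed

lemma mpoly_sum_monomials: "p = (\<Sum>m\<in>Poly_Mapping.keys p. Poly_Mapping.single m (Poly_Mapping.lookup p m))"
  by (rule poly_mapping_eqI) (auto simp: lookup_sum lookup_single when_def in_keys_iff)

lemma var_mult_single: "var v * Poly_Mapping.single m c = Poly_Mapping.single (Poly_Mapping.single v 1 + m) c"
  by (simp add: var_def mult_single)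

lemma lookup_var_mult:
  fixes p :: "('n::finite, 'k::field) mpoly"
  shows "Poly_Mapping.lookup (var v * p) (Poly_Mapping.single v 1 + m) = Poly_Mapping.lookup p m"
proof -
  have "var v * p = (\<Sum>m'\<in>Poly_Mapping.keys p.
      Poly_Mapping.single (Poly_Mapping.single v 1 + m') (Poly_Mapping.lookup p m'))"
    by (subst mpoly_sum_monomials[of p]) (simp add: sum_distrib_left var_mult_single)
  then show ?thesis
    by (auto simp: lookup_sum lookup_single when_def in_keys_iff)
qed

lemma keys_var_mult:
  fixes p :: "('n::finite, 'k::field) mpoly"
  assumes "m \<in> Poly_Mapping.keys (var v * p)"
  shows "Poly_Mapping.lookup m v > 0"
proof -
  have "m \<in> {a + b |a b. a \<in> Poly_Mapping.keys (var v :: ('n, 'k) mpoly) \<and> b \<in> Poly_Mapping.keys p}"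
    using assms keys_mult by blast
  then show ?thesis by (auto simp: var_def lookup_add)
qed

lemma single_in_homogeneous: "Poly_Mapping.single m c \<in> homogeneous (tdeg m)"
  by (simp add: homogeneous_def tdeg_def)

lemma var_in_homogeneous: "var v \<in> homogeneous 1"
  using single_in_homogeneous[of "Poly_Mapping.single v 1" 1] by (simp add: var_def)

lemma zero_notin_keys_irrelevant_ideal:
  fixes p :: "('n::finite, 'k::field) mpoly"
  assumes "p \<in> irrelevant_ideal"
  shows "0 \<notin> Poly_Mapping.keys p"
proof -
  interpret module "(*) :: ('n, 'k) mpoly \<Rightarrow> _"
    by standard (auto simp: algebra_simps)
  from assms show ?thesis
    unfolding irrelevant_ideal_def
  proof (induction rule: span_induct_alt)
    case (step c x y)
    then obtain v where "x = var v" by blast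
    then have "0 \<notin> Poly_Mapping.keys (c * x)"
      using keys_var_mult[of 0 v c] by (auto simp: mult.commute)
    then show ?case using step(2) Poly_Mapping.keys_add[of "c * x" y] by auto
  qed simp
qed

section \<open>Homogeneous components and homomorphisms of degree 0\<close>

lemma graded_module_koszul: "graded_module s G \<Longrightarrow> koszul_module (\<lambda>v. s (var v)) G"
proof -
  assume G: "graded_module s G"
  then interpret module s by (simp add: graded_module_def)
  show ?thesis
  proof
    fix d a v assume "a \<in> G d"
    then show "s (var v) a \<in> G (d + 1)"
      using G var_in_homogeneous[of v] unfolding graded_module_def by (metis of_nat_1)
  qed (use G in \<open>auto simp: graded_module_def scale_right_distrib mult.commute\<close>)
qed

lemma graded_module_module: "graded_module s G \<Longrightarrow> module s"
  by (simp add: graded_module_def)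

lemma graded_module_zero: "graded_module s G \<Longrightarrow> 0 \<in> G d"
  by (simp add: graded_module_def)

lemma graded_module_add: "graded_module s G \<Longrightarrow> a \<in> G d \<Longrightarrow> b \<in> G d \<Longrightarrow> a + b \<in> G d"
  using koszul_module.add_mem[OF graded_module_koszul] by blast

lemma graded_module_diff: "graded_module s G \<Longrightarrow> a \<in> G d \<Longrightarrow> b \<in> G d \<Longrightarrow> a - b \<in> G d"
  by (simp add: graded_module_def)

lemma graded_module_sum:
  "graded_module s G \<Longrightarrow> (\<And>j. j \<in> J \<Longrightarrow> t j \<in> G d) \<Longrightarrow> sum t J \<in> G d"
  by (induction J rule: infinite_finite_induct) (auto simp: graded_module_zero graded_module_add)

lemma graded_module_scale:
  "graded_module s G \<Longrightarrow> a \<in> G d \<Longrightarrow> s (Poly_Mapping.single m c) a \<in> G (d + int (tdeg m))"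
  using single_in_homogeneous[of m c] unfolding graded_module_def by blast

lemma homogeneous_part:
  assumes G: "graded_module s G" and "finite J" and t: "\<And>j. j \<in> J \<Longrightarrow> t j \<in> G (dg j)"
    and e: "e \<in> G d" "e = sum t J"
  shows "e = sum t {j \<in> J. dg j = d}"
proof -
  \<comment> \<open>The terms are grouped by degree and \<open>e\<close> is subtracted in degree
    \<open>d\<close>. The total is 0, so directness of the grading makes every group 0. The degree
    \<open>d\<close> is inserted into \<open>?D\<close> because no term need have it.\<close>
  let ?c = "\<lambda>d'. sum t {j \<in> J. dg j = d'} - (if d' = d then e else 0)"
  let ?D = "insert d (dg ` J)"
  have "(\<Sum>d'\<in>?D. sum t {j \<in> J. dg j = d'}) = sum t J"
    using \<open>finite J\<close> by (intro sum.group) auto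
  then have "sum ?c ?D = 0"
    using \<open>finite J\<close> e(2) by (simp add: sum_subtractf sum.delta del: sum.insert)
  moreover have "\<forall>d'\<in>?D. ?c d' \<in> G d'"
  proof
    fix d' assume "d' \<in> ?D"
    have "t j \<in> G d'" if "j \<in> {j \<in> J. dg j = d'}" for j using that t by auto
    then have "sum t {j \<in> J. dg j = d'} \<in> G d'" by (rule graded_module_sum[OF G])
    then show "?c d' \<in> G d'" using e(1) graded_module_diff[OF G] by auto
  qed
  moreover have "finite ?D" using \<open>finite J\<close> by simp
  moreover have "finite D \<Longrightarrow> \<forall>d\<in>D. c d \<in> G d \<Longrightarrow> sum c D = 0 \<Longrightarrow> \<forall>d\<in>D. c d = 0" for D c
    using G unfolding graded_module_def by blast
  ultimately have "\<forall>d'\<in>?D. ?c d' = 0" by presburger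
  then show ?thesis by simp
qed

lemma gcarrier_iff:
  assumes "graded_module s G"
  shows "a \<in> gcarrier G \<longleftrightarrow> (\<exists>D f. finite D \<and> (\<forall>d. f d \<in> G d) \<and> (\<forall>d. d \<notin> D \<longrightarrow> f d = 0) \<and> a = sum f D)"
proof
  assume "a \<in> gcarrier G"
  then obtain D f where f: "finite D" "\<forall>d\<in>D. f d \<in> G d" "a = sum f D"
    by (auto simp: gcarrier_def)
  let ?f = "\<lambda>d. if d \<in> D then f d else 0"
  have "\<forall>d. ?f d \<in> G d" "a = sum ?f D"
    using f graded_module_zero[OF assms] by auto
  then show "\<exists>D f. finite D \<and> (\<forall>d. f d \<in> G d) \<and> (\<forall>d. d \<notin> D \<longrightarrow> f d = 0) \<and> a = sum f D"
    using f(1) by (intro exI[of _ D] exI[of _ ?f]) auto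
qed (auto simp: gcarrier_def)

lemma mem_gcarrier: "graded_module s G \<Longrightarrow> a \<in> G d \<Longrightarrow> a \<in> gcarrier G"
  unfolding gcarrier_def by (intro CollectI exI[of _ "{d}"] exI[of _ "\<lambda>_. a"]) auto

lemma gcarrier_add:
  assumes G: "graded_module s G" and "a \<in> gcarrier G" "b \<in> gcarrier G"
  shows "a + b \<in> gcarrier G"
proof -
  obtain D f D' f' where
    f: "finite D" "\<forall>d. f d \<in> G d" "\<forall>d. d \<notin> D \<longrightarrow> f d = 0" "a = sum f D" and
    f': "finite D'" "\<forall>d. f' d \<in> G d" "\<forall>d. d \<notin> D' \<longrightarrow> f' d = 0" "b = sum f' D'"
    using assms unfolding gcarrier_iff[OF G] by metis
  have "a = sum f (D \<union> D')" "b = sum f' (D \<union> D')"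
    using f f' by (auto intro!: sum.mono_neutral_left)
  then have "a + b = (\<Sum>d\<in>D \<union> D'. f d + f' d)" by (simp add: sum.distrib)
  then show ?thesis
    using f(1,2) f'(1,2) graded_module_add[OF G] unfolding gcarrier_def by blast
qed

lemma graded_hom_sum:
  assumes G: "graded_module s G" and h: "graded_hom s G s' G' f"
    and "finite D" "\<And>d. d \<in> D \<Longrightarrow> c d \<in> G d"
  shows "f (sum c D) = (\<Sum>d\<in>D. f (c d))"
proof -
  have f0: "f 0 = 0"
    using h mem_gcarrier[OF G graded_module_zero[OF G]] unfolding graded_hom_def
    by (metis add.right_neutral add_left_cancel)
  have "sum c D \<in> gcarrier G \<and> f (sum c D) = (\<Sum>d\<in>D. f (c d))"
    using assms(3,4)
  proof (induction D rule: finite_induct)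
    case empty
    then show ?case using mem_gcarrier[OF G graded_module_zero[OF G]] f0 by simp
  next
    case (insert d D)
    then have "c d \<in> gcarrier G" "sum c D \<in> gcarrier G" using mem_gcarrier[OF G] by auto
    then show ?case
      using insert h gcarrier_add[OF G] unfolding graded_hom_def by auto
  qed
  then show ?thesis ..
qed

text \<open>Turns exactness on carriers, as resolutions state it, into exactness in each degree: the
  degree \<open>d\<close> component of a preimage is again a preimage.\<close>

lemma graded_hom_image:
  assumes G: "graded_module s G" and G': "graded_module s' G'" and h: "graded_hom s G s' G' f"
  shows "f ` gcarrier G \<inter> G' d = f ` G d"
proof
  show "f ` G d \<subseteq> f ` gcarrier G \<inter> G' d"
    using h mem_gcarrier[OF G] unfolding graded_hom_def by blast
  show "f ` gcarrier G \<inter> G' d \<subseteq> f ` G d"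
  proof
    fix z assume z: "z \<in> f ` gcarrier G \<inter> G' d"
    then obtain a where a: "a \<in> gcarrier G" "z = f a" by blast
    then obtain D c where c: "finite D" "\<forall>d. c d \<in> G d" "z = f (sum c D)"
      using gcarrier_iff[OF G, of a] by blast
    then have "z = (\<Sum>d\<in>D. f (c d))" using graded_hom_sum[OF G h] by blast
    then have "z = (\<Sum>j\<in>{j \<in> D. j = d}. f (c j))"
      using homogeneous_part[OF G' c(1), of "\<lambda>d. f (c d)" "\<lambda>d. d" z d] c(2) h z
      unfolding graded_hom_def by (simp add: image_subset_iff)
    also have "{j \<in> D. j = d} = (if d \<in> D then {d} else {})" by auto
    finally have "z = f (c d) \<or> z = 0" by (auto split: if_splits)
    moreover have "f 0 = 0"
      using graded_hom_sum[OF G h, of "{}"] by simp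
    ultimately show "z \<in> f ` G d"
      using c(2) graded_module_zero[OF G, of d] by auto
  qed
qed

lemma graded_hom_koszul_surj:
  assumes G: "graded_module s G" and G': "graded_module s' G'" and h: "graded_hom s G s' G' f"
  shows "koszul_surj (\<lambda>v. s (var v)) G (\<lambda>v. s' (var v)) (\<lambda>d. f ` G d) f"
proof -
  interpret N: koszul_module "\<lambda>v. s (var v)" G by (rule graded_module_koszul[OF G])
  interpret N': koszul_module "\<lambda>v. s' (var v)" G' by (rule graded_module_koszul[OF G'])
  have f_add: "f (a + b) = f a + f b" if "a \<in> G d" "b \<in> G d" for a b d
    using that h mem_gcarrier[OF G] unfolding graded_hom_def by blast
  have f_var: "f (s (var v) a) = s' (var v) (f a)" if "a \<in> G d" for a d v
    using that h mem_gcarrier[OF G] unfolding graded_hom_def by blast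
  have f0: "f 0 = 0" using f_add[OF N.zero_mem N.zero_mem] by simp
  have f_diff: "f a - f b = f (a - b)" if "a \<in> G d" "b \<in> G d" for a b d
    using f_add[OF N.diff_mem[OF that] that(2)] by simp
  show ?thesis
  proof
    fix a b d v
    show "0 \<in> f ` G d" using f0 N.zero_mem by (metis imageI)
    show "a \<in> f ` G d \<Longrightarrow> b \<in> f ` G d \<Longrightarrow> a - b \<in> f ` G d"
      using f_diff N.diff_mem by (smt (verit, ccfv_SIG) image_iff)
    show "a \<in> f ` G d \<Longrightarrow> s' (var v) a \<in> f ` G (d + 1)"
      using f_var N.x_mem by (metis (no_types, lifting) image_iff)
  qed (auto simp: N'.x_add N'.x_comm f_add f_var)
qed

section \<open>Free resolutions\<close>

locale free_graded =
  fixes s :: "('n::finite, 'k::field) mpoly \<Rightarrow> 'f::ab_group_add \<Rightarrow> 'f" and F B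
  assumes graded: "graded_module s F" and basis: "homogeneous_basis s F B"
begin

sublocale module s by (rule graded_module_module[OF graded])

sublocale koszul_module "\<lambda>v. s (var v)" F by (rule graded_module_koszul[OF graded])

lemma basis_facts: "finite B" "B \<subseteq> (\<Union>r. F r)" "independent B" "span B = gcarrier F"
  using basis by (auto simp: homogeneous_basis_def)

lemma in_span: "a \<in> F d \<Longrightarrow> a \<in> span B"
  using mem_gcarrier[OF graded] basis_facts(4) by blast

text \<open>Expanding \<open>e\<close> over the basis and the coefficients into monomials gives
  homogeneous terms, of which only those of total degree \<open>d\<close> survive. Hence
  divisibility by a variable has to be checked only for these.\<close>

lemma var_multiplesI:
  assumes e: "e \<in> F d"
    and supp: "\<And>b m. b \<in> B \<Longrightarrow> m \<in> Poly_Mapping.keys (representation B e b) \<Longrightarrow>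
      b \<in> F (d - int (tdeg m)) \<Longrightarrow> \<exists>v\<in>set vs. Poly_Mapping.lookup m v > 0"
  shows "e \<in> var_multiples (\<lambda>v. s (var v)) F vs d"
proof -
  obtain dg where dg: "\<And>b. b \<in> B \<Longrightarrow> b \<in> F (dg b)"
    using basis_facts(2) by (metis UN_iff subsetD)
  let ?J = "SIGMA b:B. Poly_Mapping.keys (representation B e b)"
  let ?t = "\<lambda>(b, m). s (Poly_Mapping.single m (Poly_Mapping.lookup (representation B e b) m)) b"
  have "e = (\<Sum>b\<in>B. s (representation B e b) b)"
    using sum_representation_eq[OF basis_facts(3) in_span[OF e] basis_facts(1) order_refl] by simp
  also have "\<dots> = (\<Sum>b\<in>B. \<Sum>m\<in>Poly_Mapping.keys (representation B e b). ?t (b, m))"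
    by (subst mpoly_sum_monomials) (simp add: scale_sum_left)
  also have "\<dots> = sum ?t ?J"
    using basis_facts(1) by (subst sum.Sigma) auto
  finally have "e = sum ?t {j \<in> ?J. (\<lambda>(b, m). dg b + int (tdeg m)) j = d}"
    using e basis_facts(1) dg
    by (intro homogeneous_part[OF graded]) (auto intro!: graded_module_scale[OF graded])
  moreover have "?t j \<in> var_multiples (\<lambda>v. s (var v)) F vs d"
    if j': "j \<in> {j \<in> ?J. (\<lambda>(b, m). dg b + int (tdeg m)) j = d}" for j
  proof -
    obtain b m where j: "j = (b, m)" "b \<in> B" "m \<in> Poly_Mapping.keys (representation B e b)"
        "d = dg b + int (tdeg m)"
      using j' by auto
    have "b \<in> F (d - int (tdeg m))" using dg[OF j(2)] j(4) by simp
    then obtain v where v: "v \<in> set vs" "Poly_Mapping.lookup m v > 0"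
      using supp[OF j(2,3)] by blast
    define m' where "m' = m - Poly_Mapping.single v 1"
    have m: "m = Poly_Mapping.single v 1 + m'" unfolding m'_def by (rule monomial_split[OF v(2)])
    let ?c = "Poly_Mapping.lookup (representation B e b) m"
    have "tdeg m = 1 + tdeg m'" by (subst m) (simp only: tdeg_add tdeg_single)
    then have "s (Poly_Mapping.single m' ?c) b \<in> F (d - 1)"
      using graded_module_scale[OF graded dg[OF j(2)], of m' ?c] j(4) by simp
    moreover have "?t j = s (var v) (s (Poly_Mapping.single m' ?c) b)"
      unfolding j(1) by (simp add: var_mult_single del: One_nat_def flip: m)
    ultimately show ?thesis using x_in_var_multiples[OF v(1)] by metis
  qed
  moreover have "sum f J \<in> var_multiples (\<lambda>v. s (var v)) F vs d"
    if "\<And>j. j \<in> J \<Longrightarrow> f j \<in> var_multiples (\<lambda>v. s (var v)) F vs d" for J and f :: "'f \<times> ('n \<Rightarrow>\<^sub>0 nat) \<Rightarrow> 'f"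
    using that by (induction J rule: infinite_finite_induct)
      (auto simp: var_multiples_zero var_multiples_add)
  ultimately show ?thesis by (metis (no_types, lifting))
qed

lemma keys_var_multiples:
  assumes "e \<in> var_multiples (\<lambda>v. s (var v)) F vs d"
  shows "e \<in> span B" "m \<in> Poly_Mapping.keys (representation B e b) \<Longrightarrow> \<exists>v\<in>set vs. Poly_Mapping.lookup m v > 0"
proof -
  have "e \<in> span B \<and> (\<forall>b m. m \<in> Poly_Mapping.keys (representation B e b) \<longrightarrow>
      (\<exists>v\<in>set vs. Poly_Mapping.lookup m v > 0))"
    using assms
  proof (induction vs arbitrary: e)
    case Nil
    then show ?case by (simp add: span_zero representation_zero)
  next
    case (Cons w vs)
    then obtain a c where ac: "e = s (var w) a + c" "a \<in> F (d - 1)"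
        "c \<in> var_multiples (\<lambda>v. s (var v)) F vs d"
      by auto
    have rep: "representation B e b = var w * representation B a b + representation B c b" for b
      unfolding ac(1) using Cons.IH[OF ac(3)] in_span[OF ac(2)]
      by (simp add: representation_add representation_scale basis_facts(3) span_scale)
    have "\<exists>v\<in>set (w # vs). Poly_Mapping.lookup m v > 0"
      if "m \<in> Poly_Mapping.keys (representation B e b)" for b m
    proof -
      from that have "m \<in> Poly_Mapping.keys (var w * representation B a b) \<or>
          m \<in> Poly_Mapping.keys (representation B c b)"
        unfolding rep using Poly_Mapping.keys_add[of "var w * representation B a b" "representation B c b"]
        by blast
      then show ?thesis using keys_var_mult[of m w "representation B a b"] Cons.IH[OF ac(3)] by auto
    qed
    then show ?case using ac(1) Cons.IH[OF ac(3)] in_span[OF ac(2)] by (auto simp: span_add span_scale)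
  qed
  then show "e \<in> span B" "m \<in> Poly_Mapping.keys (representation B e b) \<Longrightarrow> \<exists>v\<in>set vs. Poly_Mapping.lookup m v > 0"
    by blast+
qed

text \<open>Membership in (vs) F is visible on the monomials of the coefficients. Multiplication by
  \<open>w\<close> shifts these injectively and, \<open>w\<close> not being in \<open>vs\<close>,
  does not affect their divisibility by \<open>vs\<close>.\<close>

lemma regular_free: "distinct vs \<Longrightarrow> regular (\<lambda>v. s (var v)) F vs"
proof (induction vs)
  case (Cons w vs)
  have "e \<in> var_multiples (\<lambda>v. s (var v)) F vs d"
    if e: "e \<in> F d" "s (var w) e \<in> var_multiples (\<lambda>v. s (var v)) F vs (d + 1)" for e d
  proof (rule var_multiplesI[OF e(1)])
    fix b m assume m: "m \<in> Poly_Mapping.keys (representation B e b)"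
    have "representation B (s (var w) e) b = var w * representation B e b"
      using in_span[OF e(1)] by (simp add: representation_scale basis_facts(3))
    then have "Poly_Mapping.single w 1 + m \<in> Poly_Mapping.keys (representation B (s (var w) e) b)"
      using m by (simp add: in_keys_iff lookup_var_mult del: One_nat_def)
    then obtain v where v: "v \<in> set vs" "Poly_Mapping.lookup (Poly_Mapping.single w 1 + m) v > 0"
      using keys_var_multiples(2)[OF e(2)] by blast
    then have "v \<noteq> w" using Cons.prems by auto
    then show "\<exists>v\<in>set vs. Poly_Mapping.lookup m v > 0"
      using v by (auto simp: lookup_add lookup_single when_def)
  qed
  then show ?case using Cons by simp
qed simp

text \<open>Elements of R_+ F have coefficients without constant term, and every other monomial is
  divisible by some variable. This brings the minimality condition into the form in which top Koszul
  boundaries appear.\<close>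

lemma span_irrelevant_subset_var_multiples:
  assumes e: "e \<in> F d" "e \<in> span {s p a | p a. p \<in> irrelevant_ideal \<and> a \<in> gcarrier F}"
    and "set vs = UNIV"
  shows "e \<in> var_multiples (\<lambda>v. s (var v)) F vs d"
proof -
  have "e \<in> span B \<and> (\<forall>b. 0 \<notin> Poly_Mapping.keys (representation B e b))"
    using e(2)
  proof (induction rule: span_induct_alt)
    case base
    then show ?case by (simp add: span_zero representation_zero)
  next
    case (step c z y)
    then obtain p a where z: "z = s p a" "p \<in> irrelevant_ideal" "a \<in> span B"
      using basis_facts(4) by blast
    have rep: "representation B (s c z + y) b = (c * representation B a b) * p + representation B y b" for b
      using step.IH z
      by (simp add: representation_add representation_scale basis_facts(3) span_scale ac_simps)
    have "0 \<notin> Poly_Mapping.keys (q * p)" for q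
    proof
      assume "0 \<in> Poly_Mapping.keys (q * p)"
      then obtain a b where "0 = a + b" "b \<in> Poly_Mapping.keys p"
        using keys_mult[of q p] by blast
      then have "tdeg (a + b) = 0" by (metis tdeg_eq_0_iff)
      then have "tdeg b = 0" unfolding tdeg_add by simp
      then show False
        using zero_notin_keys_irrelevant_ideal[OF z(2)] \<open>b \<in> _\<close> tdeg_eq_0_iff by metis
    qed
    then have "0 \<notin> Poly_Mapping.keys (representation B (s c z + y) b)" for b
      unfolding rep using step.IH
        Poly_Mapping.keys_add[of "c * representation B a b * p" "representation B y b"] by blast
    then show ?case using step.IH z by (simp add: span_add span_scale)
  qed
  then show ?thesis
    using e(1) assms(3) by (intro var_multiplesI) (auto, metis gr0I poly_mapping_eqI lookup_zero)
qed

end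

text \<open>One step of a minimal free resolution: \<open>Q\<close> is \<open>M\<close> at the first
  step and a syzygy module at the later ones.\<close>

locale minimal_cover = free_graded s F B + koszul_surj "\<lambda>v. s (var v)" F y Q \<phi>
  for s :: "('n::finite, 'k::field) mpoly \<Rightarrow> 'f::ab_group_add \<Rightarrow> 'f" and F B
    and y :: "'n \<Rightarrow> 'b::ab_group_add \<Rightarrow> 'b" and Q \<phi> +
  fixes vs :: "'n list"
  assumes vs: "distinct vs" "set vs = UNIV"
    and minimal: "ker d \<subseteq> var_multiples (\<lambda>v. s (var v)) F vs d"
begin

lemma koszul_acyclic_cover: "p < int (length vs) \<Longrightarrow> koszul_acyclic (\<lambda>v. s (var v)) F vs p r"
  using koszul_acyclic_regular regular_free vs(1) by blast

text \<open>Below the top the cohomology of \<open>F\<close> vanishes at both positions involved. At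
  \<open>p + 1 = int (length vs)\<close> it need not, but minimality says exactly that the top
  cochains of the kernel are boundaries in \<open>F\<close>.\<close>

lemma koszul_acyclic_syzygy:
  assumes "p < int (length vs)"
  shows "koszul_acyclic (\<lambda>v. s (var v)) ker vs (p + 1) r \<longleftrightarrow> koszul_acyclic y Q vs p r"
proof (rule koszul_acyclic_shift[OF _ koszul_acyclic_cover[OF assms]])
  fix f assume f: "f \<in> cochains (length vs) (p + 1) r ker" "koszul_d (\<lambda>v. s (var v)) vs f = (\<lambda>_. 0)"
  show "\<exists>g\<in>cochains (length vs) p r F. koszul_d (\<lambda>v. s (var v)) vs g = f"
  proof (cases "p + 1 = int (length vs)")
    case True
    obtain e where e: "e \<in> ker (r + int (length vs))" "f = top_cell (length vs) e"
      using f(1)[unfolded True] by (rule cochains_topE)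
    have "p = int (length vs) - 1" using True by simp
    then show ?thesis
      using top_cell_boundary_iff[of vs "r + int (length vs)" e] minimal e by auto
  next
    case False
    then have "koszul_acyclic (\<lambda>v. s (var v)) F vs (p + 1) r" using koszul_acyclic_cover assms by simp
    then show ?thesis using f unfolding koszul_acyclic_def cochains_ker_iff by (metis add_diff_cancel_right')
  qed
qed

text \<open>The top cohomology is Q / R_+ Q, which equals F / R_+ F because the kernel lies in R_+
  F. The basis elements remain independent there.\<close>

lemma koszul_acyclic_top_iff_no_generator:
  "koszul_acyclic y Q vs (int (length vs)) r \<longleftrightarrow> B \<inter> F (r + int (length vs)) = {}"
proof -
  let ?D = "r + int (length vs)"
  have "Q ?D \<subseteq> var_multiples y Q vs ?D \<longleftrightarrow> B \<inter> F ?D = {}"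
  proof
    assume no: "B \<inter> F ?D = {}"
    show "Q ?D \<subseteq> var_multiples y Q vs ?D"
    proof
      fix q assume "q \<in> Q ?D"
      then obtain e where e: "e \<in> F ?D" "\<phi> e = q" using \<phi>_image by (metis imageE)
      have "e \<in> var_multiples (\<lambda>v. s (var v)) F vs ?D"
      proof (rule var_multiplesI[OF e(1)])
        fix b and m :: "'n \<Rightarrow>\<^sub>0 nat" assume b: "b \<in> B" "b \<in> F (?D - int (tdeg m))"
        then have "tdeg m \<noteq> 0" using no by auto
        then show "\<exists>v\<in>set vs. Poly_Mapping.lookup m v > 0"
          using vs(2) by (auto simp: tdeg_def)
      qed
      then show "q \<in> var_multiples y Q vs ?D" using \<phi>_var_multiples e(2) by blast
    qed
  next
    assume Q: "Q ?D \<subseteq> var_multiples y Q vs ?D"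
    show "B \<inter> F ?D = {}"
    proof (rule ccontr)
      assume "B \<inter> F ?D \<noteq> {}"
      then obtain b where b: "b \<in> B" "b \<in> F ?D" by blast
      then have "\<phi> b \<in> var_multiples y Q vs ?D" using Q \<phi>_image by blast
      then obtain e where e: "e \<in> var_multiples (\<lambda>v. s (var v)) F vs ?D" "\<phi> e = \<phi> b"
        using var_multiples_lift by blast
      then have "b - e \<in> ker ?D"
        using b(2) \<phi>_var_multiples[OF e(1)] \<phi>_diff diff_mem by (simp add: ker_def)
      then have "b - e \<in> var_multiples (\<lambda>v. s (var v)) F vs ?D" using minimal by blast
      then have "b \<in> var_multiples (\<lambda>v. s (var v)) F vs ?D"
        using var_multiples_add[OF _ e(1)] by fastforce
      \<comment> \<open>The coordinate of \<open>b\<close> at itself is 1, a constant term, which no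
        element of R_+ F can have.\<close>
      moreover have "0 \<in> Poly_Mapping.keys (representation B b b)"
        using b(1) basis_facts(3) by (simp add: representation_basis)
      ultimately show False using keys_var_multiples(2) by fastforce
    qed
  qed
  then show ?thesis by (simp add: cod.koszul_acyclic_top_iff)
qed

end

text \<open>Each passage to the next syzygy module raises the Koszul position by one, until it is
  the top. For j > n the position is negative and the left side holds, so the equivalence also
  bounds the length of the resolution by n.\<close>

lemma koszul_minimal_resolution:
  fixes s :: "('n::finite, 'k::field) mpoly \<Rightarrow> 'm::ab_group_add \<Rightarrow> 'm"
    and sF :: "('n, 'k) mpoly \<Rightarrow> 'f::ab_group_add \<Rightarrow> 'f"
  assumes M: "graded_module s M" and res: "minimal_graded_free_resolution s M sF F B \<epsilon> \<delta>"
    and vs: "distinct vs" "set vs = (UNIV :: 'n set)"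
  shows "koszul_acyclic (\<lambda>v. s (var v)) M vs (int (length vs) - int j) r \<longleftrightarrow>
    B j \<inter> F j (r + int (length vs)) = {}"
proof -
  let ?n = "int (length vs)"
  have F: "graded_module sF (F i)" "free_graded sF (F i) (B i)" for i
    using res by (auto simp: minimal_graded_free_resolution_def free_graded_def)
  have eps: "graded_hom sF (F 0) s M \<epsilon>" and del: "graded_hom sF (F (Suc i)) sF (F i) (\<delta> i)" for i
    using res by (auto simp: minimal_graded_free_resolution_def)
  \<comment> \<open>\<open>W i\<close> is a syzygy module inside \<open>F i\<close>; it is the
    kernel of one step and the module covered by the next.\<close>
  define W where "W i d = \<delta> i ` F (Suc i) d" for i d
  have W: "W i d = \<delta> i ` gcarrier (F (Suc i)) \<inter> F i d" for i d
    unfolding W_def using graded_hom_image[OF F(1) F(1) del] by simp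
  have eps_image: "\<epsilon> ` F 0 d = M d" for d
    using graded_hom_image[OF F(1) M eps, of d] res mem_gcarrier[OF M]
    by (auto simp: minimal_graded_free_resolution_def)
  have W0: "{a \<in> F 0 d. \<epsilon> a = 0} = W 0 d" for d
    unfolding W using res mem_gcarrier[OF F(1)] by (auto simp: minimal_graded_free_resolution_def)
  have W_Suc: "{a \<in> F (Suc i) d. \<delta> i a = 0} = W (Suc i) d" for i d
    unfolding W using res mem_gcarrier[OF F(1)] by (auto simp: minimal_graded_free_resolution_def)
  have min: "W i d \<subseteq> var_multiples (\<lambda>v. sF (var v)) (F i) vs d" for i d
  proof
    fix e assume "e \<in> W i d"
    then have "e \<in> F i d" "e \<in> module.span sF {sF p x | p x. p \<in> irrelevant_ideal \<and> x \<in> gcarrier (F i)}"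
      unfolding W using res unfolding minimal_graded_free_resolution_def by blast+
    then show "e \<in> var_multiples (\<lambda>v. sF (var v)) (F i) vs d"
      using free_graded.span_irrelevant_subset_var_multiples[OF F(2) _ _ vs(2)] by blast
  qed
  have eps_surj: "koszul_surj (\<lambda>v. sF (var v)) (F 0) (\<lambda>v. s (var v)) M \<epsilon>"
    using graded_hom_koszul_surj[OF F(1) M eps] unfolding eps_image .
  have eps_ker: "koszul_surj.ker (F 0) \<epsilon> = W 0"
    unfolding koszul_surj.ker_def[OF eps_surj] W0 by (rule ext) simp
  interpret zero: minimal_cover sF "F 0" "B 0" "\<lambda>v. s (var v)" M \<epsilon> vs
    using F(2) eps_surj vs min unfolding minimal_cover_def minimal_cover_axioms_def eps_ker by blast
  have del_surj: "koszul_surj (\<lambda>v. sF (var v)) (F (Suc i)) (\<lambda>v. sF (var v)) (W i) (\<delta> i)" for i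
    using graded_hom_koszul_surj[OF F(1) F(1) del] unfolding W_def .
  have del_ker: "koszul_surj.ker (F (Suc i)) (\<delta> i) = W (Suc i)" for i
    unfolding koszul_surj.ker_def[OF del_surj] W_Suc by (rule ext) simp
  have suc: "minimal_cover sF (F (Suc i)) (B (Suc i)) (\<lambda>v. sF (var v)) (W i) (\<delta> i) vs" for i
    using F(2) del_surj vs min unfolding minimal_cover_def minimal_cover_axioms_def del_ker by blast
  have shift: "koszul_acyclic (\<lambda>v. sF (var v)) (W i) vs (?n - int k) r \<longleftrightarrow>
      koszul_acyclic (\<lambda>v. sF (var v)) (W (i + k)) vs ?n r" for i k
  proof (induction k arbitrary: i)
    case (Suc k)
    have "koszul_acyclic (\<lambda>v. sF (var v)) (W (Suc i)) vs (?n - int (Suc k) + 1) r \<longleftrightarrow>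
        koszul_acyclic (\<lambda>v. sF (var v)) (W i) vs (?n - int (Suc k)) r"
      using minimal_cover.koszul_acyclic_syzygy[OF suc, of "?n - int (Suc k)" i r] unfolding del_ker by simp
    then show ?case using Suc[of "Suc i"] by (simp add: algebra_simps)
  qed simp
  show ?thesis
  proof (cases j)
    case 0
    then show ?thesis using zero.koszul_acyclic_top_iff_no_generator by simp
  next
    case (Suc k)
    have "koszul_acyclic (\<lambda>v. s (var v)) M vs (?n - int j) r \<longleftrightarrow>
        koszul_acyclic (\<lambda>v. sF (var v)) (W 0) vs (?n - int j + 1) r"
      using zero.koszul_acyclic_syzygy[of "?n - int j" r] Suc unfolding eps_ker by simp
    also have "?n - int j + 1 = ?n - int k" using Suc by simp
    also have "koszul_acyclic (\<lambda>v. sF (var v)) (W 0) vs (?n - int k) r \<longleftrightarrow> B (Suc k) \<inter> F (Suc k) (r + ?n) = {}"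
      using shift[of 0 k] minimal_cover.koszul_acyclic_top_iff_no_generator[OF suc] by simp
    finally show ?thesis using Suc by simp
  qed
qed

section \<open>Injective resolutions\<close>

text \<open>Supplies the test modules for injectivity: the ring and its monomial ideals, shifted so
  that 1 has degree \<open>r\<close>.\<close>

lemma monomial_ideal_graded:
  fixes V :: "('n::finite \<Rightarrow>\<^sub>0 nat) set"
  assumes up: "\<And>m m'. m \<in> V \<Longrightarrow> m' + m \<in> V"
  shows "graded_module ((*) :: ('n, 'k::field) mpoly \<Rightarrow> _)
    (\<lambda>d. {p. \<forall>m\<in>Poly_Mapping.keys p. m \<in> V \<and> r + int (tdeg m) = d})"
    (is "graded_module _ ?G")
  unfolding graded_module_def
proof (intro conjI allI ballI impI)
  show "module ((*) :: ('n, 'k) mpoly \<Rightarrow> _)"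
    by standard (auto simp: algebra_simps)
  show "0 \<in> ?G d" for d by simp
  show "p - q \<in> ?G d" if "p \<in> ?G d" "q \<in> ?G d" for p q :: "('n, 'k) mpoly" and d
  proof -
    have "m \<in> Poly_Mapping.keys p \<or> m \<in> Poly_Mapping.keys q" if "m \<in> Poly_Mapping.keys (p - q)" for m
      using that by (auto simp: in_keys_iff lookup_minus)
    then show ?thesis using that by blast
  qed
  show "q * p \<in> ?G (d + int e)" if "q \<in> homogeneous e" "p \<in> ?G d" for p q :: "('n, 'k) mpoly" and d e
  proof -
    have "m \<in> V \<and> r + int (tdeg m) = d + int e" if m: "m \<in> Poly_Mapping.keys (q * p)" for m
    proof -
      obtain a b where ab: "m = a + b" "a \<in> Poly_Mapping.keys q" "b \<in> Poly_Mapping.keys p"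
        using m keys_mult[of q p] by blast
      then have "tdeg a = e" "b \<in> V" "r + int (tdeg b) = d"
        using \<open>q \<in> homogeneous e\<close> \<open>p \<in> ?G d\<close> by (auto simp: homogeneous_def tdeg_def)
      then show ?thesis using ab(1) up by (simp add: tdeg_add)
    qed
    then show ?thesis by blast
  qed
  show "f d = 0" if "finite D" "\<forall>d\<in>D. f d \<in> ?G d" "sum f D = 0" "d \<in> D"
    for D and f :: "int \<Rightarrow> ('n, 'k) mpoly" and d
  proof (rule ccontr)
    assume "f d \<noteq> 0"
    then obtain m where m: "m \<in> Poly_Mapping.keys (f d)" by fastforce
    have "Poly_Mapping.lookup (f d') m = 0" if "d' \<in> D - {d}" for d'
    proof (rule ccontr)
      assume "Poly_Mapping.lookup (f d') m \<noteq> 0"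
      then have "m \<in> Poly_Mapping.keys (f d')" by (simp add: in_keys_iff)
      then have "r + int (tdeg m) = d'" "r + int (tdeg m) = d"
        using that m \<open>\<forall>d\<in>D. f d \<in> ?G d\<close> \<open>d \<in> D\<close> by blast+
      then show False using that by simp
    qed
    then have "(\<Sum>d'\<in>D. Poly_Mapping.lookup (f d') m) = Poly_Mapping.lookup (f d) m"
      using that(1,4) by (simp add: sum.remove)
    then show False using that(3) m by (metis in_keys_iff lookup_sum lookup_zero)
  qed
qed

text \<open>A family \<open>w\<close> compatible with the variables is a homomorphism on the
  monomial ideal spanned by \<open>U\<close>. Injectivity extends it to the whole ring, and
  \<open>a\<close> is the image of 1.\<close>

lemma injective_extend_monomials:
  fixes sE :: "('n::finite, 'k::field) mpoly \<Rightarrow> 'e::ab_group_add \<Rightarrow> 'e"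
  assumes inj: "graded_injective sE E"
    and up: "\<And>m v. m \<in> U \<Longrightarrow> Poly_Mapping.single v 1 + m \<in> U"
    and w_mem: "\<And>m. m \<in> U \<Longrightarrow> w m \<in> E (r + int (tdeg m))"
    and w_step: "\<And>m v. m \<in> U \<Longrightarrow> w (Poly_Mapping.single v 1 + m) = sE (var v) (w m)"
  shows "\<exists>a\<in>E r. \<forall>m\<in>U. sE (Poly_Mapping.single m 1) a = w m"
proof -
  have E: "graded_module sE E" using inj by (simp add: graded_injective_def)
  interpret module sE by (rule graded_module_module[OF E])
  have up': "m' + m \<in> U \<and> w (m' + m) = sE (Poly_Mapping.single m' 1) (w m)" if "m \<in> U" for m m'
  proof (induction m' rule: monomial_induct)
    case zero
    then show ?case using that by simp
  next
    case (step v m')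
    then show ?case
      using up[of "m' + m" v] w_step[of "m' + m" v] var_mult_single[of v m' "1 :: 'k"]
      by (simp add: add.assoc)
  qed
  define R :: "int \<Rightarrow> ('n, 'k) mpoly set"
    where "R d = {p. \<forall>m\<in>Poly_Mapping.keys p. m \<in> UNIV \<and> r + int (tdeg m) = d}" for d
  define A :: "int \<Rightarrow> ('n, 'k) mpoly set"
    where "A d = {p. \<forall>m\<in>Poly_Mapping.keys p. m \<in> U \<and> r + int (tdeg m) = d}" for d
  have R: "graded_module (*) R" unfolding R_def by (rule monomial_ideal_graded) simp
  have A: "graded_module (*) A" unfolding A_def by (rule monomial_ideal_graded) (use up' in blast)
  \<comment> \<open>The \<open>k\<close>-linear extension of \<open>w\<close>, the scalars of
    \<open>k\<close> being the monomials with exponent 0. It is total, but multiplicativity is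
    claimed only on polynomials supported in \<open>U\<close>.\<close>
  define f where "f p = (\<Sum>m\<in>Poly_Mapping.keys p. sE (Poly_Mapping.single 0 (Poly_Mapping.lookup p m)) (w m))"
    for p :: "('n, 'k) mpoly"
  have f_eq: "f p = (\<Sum>m\<in>X. sE (Poly_Mapping.single 0 (Poly_Mapping.lookup p m)) (w m))"
    if "finite X" "Poly_Mapping.keys p \<subseteq> X" for p X
    unfolding f_def using that by (intro sum.mono_neutral_left) (auto simp: in_keys_iff)
  have f_add: "f (p + q) = f p + f q" for p q
  proof -
    let ?X = "Poly_Mapping.keys p \<union> Poly_Mapping.keys q"
    have "f (p + q) = (\<Sum>m\<in>?X. sE (Poly_Mapping.single 0 (Poly_Mapping.lookup (p + q) m)) (w m))"
      using Poly_Mapping.keys_add[of p q] by (intro f_eq) auto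
    also have "\<dots> = f p + f q"
      using f_eq[of ?X p] f_eq[of ?X q]
      by (simp add: lookup_add single_add scale_left_distrib sum.distrib)
    finally show ?thesis .
  qed
  have f_sum: "f (sum t J) = (\<Sum>j\<in>J. f (t j))" for t :: "('n \<Rightarrow>\<^sub>0 nat) \<Rightarrow> _" and J
  proof (induction J rule: infinite_finite_induct)
    case (insert j J)
    then show ?case by (simp add: f_add)
  qed (simp_all add: f_def)
  have f_single: "f (Poly_Mapping.single m c) = sE (Poly_Mapping.single 0 c) (w m)" for m c
    using f_eq[of "{m}" "Poly_Mapping.single m c"] by simp
  have f_single_mult: "f (Poly_Mapping.single m' c * Poly_Mapping.single m a) =
      sE (Poly_Mapping.single m' c) (f (Poly_Mapping.single m a))" if "m \<in> U" for m m' c a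
    using up'[OF that, of m'] by (simp add: mult_single f_single)
  have f_mult: "f (q * p) = sE q (f p)" if "Poly_Mapping.keys p \<subseteq> U" for q p
  proof -
    let ?q = "\<lambda>m. Poly_Mapping.single m (Poly_Mapping.lookup q m)"
    let ?p = "\<lambda>m. Poly_Mapping.single m (Poly_Mapping.lookup p m)"
    have "q * p = (\<Sum>m'\<in>Poly_Mapping.keys q. \<Sum>m\<in>Poly_Mapping.keys p. ?q m' * ?p m)"
      using arg_cong2[OF mpoly_sum_monomials[of q] mpoly_sum_monomials[of p], of "(*)"]
      unfolding sum_product .
    then have "f (q * p) = (\<Sum>m'\<in>Poly_Mapping.keys q. \<Sum>m\<in>Poly_Mapping.keys p. f (?q m' * ?p m))"
      by (simp add: f_sum)
    also have "\<dots> = (\<Sum>m'\<in>Poly_Mapping.keys q. \<Sum>m\<in>Poly_Mapping.keys p. sE (?q m') (f (?p m)))"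
      using that by (intro sum.cong refl f_single_mult) auto
    also have "\<dots> = (\<Sum>m'\<in>Poly_Mapping.keys q. sE (?q m') (f p))"
      using arg_cong[OF mpoly_sum_monomials[of p], of f]
      by (simp only: f_sum flip: scale_sum_right)
    also have "\<dots> = sE q (f p)"
      using arg_cong[OF mpoly_sum_monomials[of q], of "\<lambda>q. sE q (f p)"]
      by (simp only: scale_sum_left)
    finally show ?thesis .
  qed
  have gA: "Poly_Mapping.keys p \<subseteq> U" if p: "p \<in> gcarrier A" for p
  proof -
    obtain D c where c: "\<forall>d\<in>D. c d \<in> A d" "p = sum c D"
      using p unfolding gcarrier_def by blast
    then have "\<forall>d\<in>D. Poly_Mapping.keys (c d) \<subseteq> U" unfolding A_def by blast
    then show ?thesis unfolding c(2) using Poly_Mapping.keys_sum[of c D] by blast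
  qed
  have "f p \<in> E d" if "p \<in> A d" for p d
    unfolding f_def
  proof (rule graded_module_sum[OF E])
    fix m assume "m \<in> Poly_Mapping.keys p"
    then have "m \<in> U" "r + int (tdeg m) = d" using that by (auto simp: A_def)
    then show "sE (Poly_Mapping.single 0 (Poly_Mapping.lookup p m)) (w m) \<in> E d"
      using graded_module_scale[OF E w_mem, of m 0] by auto
  qed
  then have "graded_hom (*) A sE E f"
    unfolding graded_hom_def using f_add f_mult gA by blast
  moreover have "\<forall>d. A d \<subseteq> R d" unfolding A_def R_def by blast
  ultimately obtain g where g: "graded_hom (*) R sE E g" "\<forall>p\<in>gcarrier A. g p = f p"
    using inj R A unfolding graded_injective_def by blast
  have one: "1 \<in> R r" by (simp add: R_def tdeg_def)
  have "sE (Poly_Mapping.single m 1) (g 1) = w m" if "m \<in> U" for m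
  proof -
    have "Poly_Mapping.single m 1 \<in> A (r + int (tdeg m))" using that by (simp add: A_def)
    then have "g (Poly_Mapping.single m 1) = f (Poly_Mapping.single m 1)"
      using g(2) mem_gcarrier[OF A] by blast
    also have "\<dots> = w m" by (simp add: f_single)
    finally show ?thesis
      using g(1) mem_gcarrier[OF R one] unfolding graded_hom_def by (metis mult.right_neutral)
  qed
  then show ?thesis using g(1) one unfolding graded_hom_def by blast
qed

text \<open>Dividing \<open>e\<close> by \<open>w\<close> inside the part killed by
  \<open>vs\<close> means extending a homomorphism from the ideal generated by \<open>w\<close> and
  \<open>vs\<close> to the ring, namely the one that sends \<open>w\<close> to \<open>e\<close> and
  \<open>vs\<close> to 0. It is well defined because \<open>vs\<close> kills \<open>e\<close> and
  \<open>w\<close> is not in \<open>vs\<close>.\<close>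

lemma coregular_injective:
  fixes sE :: "('n::finite, 'k::field) mpoly \<Rightarrow> 'e::ab_group_add \<Rightarrow> 'e"
  assumes inj: "graded_injective sE E"
  shows "distinct vs \<Longrightarrow> coregular (\<lambda>v. sE (var v)) E vs"
proof (induction vs)
  case (Cons w vs)
  have E: "graded_module sE E" using inj by (simp add: graded_injective_def)
  interpret module sE by (rule graded_module_module[OF E])
  have "\<exists>e'\<in>E (d - 1). sE (var w) e' = e \<and> (\<forall>v\<in>set vs. sE (var v) e' = 0)"
    if e: "e \<in> E d" "\<forall>v\<in>set vs. sE (var v) e = 0" for e d
  proof -
    define hit where "hit m \<longleftrightarrow> (\<exists>v\<in>set vs. Poly_Mapping.lookup m v > 0)" for m :: "'n \<Rightarrow>\<^sub>0 nat"
    define U where "U = {m. hit m \<or> Poly_Mapping.lookup m w > 0}"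
    \<comment> \<open>The prescribed product of \<open>m\<close> with the new element: 0 if
      \<open>m\<close> has a factor in \<open>vs\<close>, otherwise (m / w) e. In the second case
      \<open>w\<close> divides \<open>m\<close> whenever \<open>m\<close> is in \<open>U\<close>, so
      the difference of exponents is not truncated.\<close>
    define a where "a m = (if hit m then 0 else sE (Poly_Mapping.single (m - Poly_Mapping.single w 1) 1) e)" for m
    have "\<exists>y\<in>E (d - 1). \<forall>m\<in>U. sE (Poly_Mapping.single m 1) y = a m"
    proof (rule injective_extend_monomials[OF inj])
      fix m v assume m: "m \<in> U"
      then show "Poly_Mapping.single v 1 + m \<in> U"
        by (auto simp: U_def hit_def lookup_add)
      show "a m \<in> E (d - 1 + int (tdeg m))"
      proof (cases "hit m")
        case True
        then show ?thesis by (simp add: a_def graded_module_zero[OF E])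
      next
        case False
        then have "Poly_Mapping.lookup m w > 0" using m by (simp add: U_def)
        then have "tdeg m = 1 + tdeg (m - Poly_Mapping.single w 1)"
          by (metis monomial_split tdeg_add tdeg_single)
        then show ?thesis
          using False graded_module_scale[OF E e(1), of "m - Poly_Mapping.single w 1" 1]
          by (simp add: a_def)
      qed
      show "a (Poly_Mapping.single v 1 + m) = sE (var v) (a m)"
      proof (cases "hit m")
        case True
        then have "hit (Poly_Mapping.single v 1 + m)" by (auto simp: hit_def lookup_add)
        then show ?thesis using True by (simp add: a_def)
      next
        case False
        then have "Poly_Mapping.lookup m w > 0" using m by (simp add: U_def)
        then have "Poly_Mapping.single v 1 + m - Poly_Mapping.single w 1 =
            Poly_Mapping.single v 1 + (m - Poly_Mapping.single w 1)"
          by (intro poly_mapping_eqI) (auto simp: lookup_add lookup_minus lookup_single when_def)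
        then have *: "sE (Poly_Mapping.single (Poly_Mapping.single v 1 + m - Poly_Mapping.single w 1) 1) e =
            sE (var v) (sE (Poly_Mapping.single (m - Poly_Mapping.single w 1) 1) e)"
          by (simp add: var_mult_single)
        show ?thesis
        \<comment> \<open>A variable of \<open>vs\<close> moves \<open>m\<close> to where the
          prescribed value is 0; the other side is 0 as well because \<open>v\<close> kills
          \<open>e\<close>.\<close>
        proof (cases "v \<in> set vs")
          case True
          then have "hit (Poly_Mapping.single v 1 + m)"
            unfolding hit_def by (intro bexI[of _ v]) (auto simp: lookup_add)
          then show ?thesis
            using True False e(2) scale_left_commute[of "var v" _ e] by (simp add: a_def)
        next
          case False
          then have "hit (Poly_Mapping.single v 1 + m) \<longleftrightarrow> hit m"
            by (auto simp: hit_def lookup_add lookup_single when_def)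
          then show ?thesis using * \<open>\<not> hit m\<close> by (simp add: a_def)
        qed
      qed
    qed
    then obtain y where y: "y \<in> E (d - 1)" "\<forall>m\<in>U. sE (Poly_Mapping.single m 1) y = a m" by blast
    have "sE (var v) y = 0" if "v \<in> set vs" for v
    proof -
      have "hit (Poly_Mapping.single v 1)" unfolding hit_def using that by (intro bexI[of _ v]) auto
      then show ?thesis using y(2) by (auto simp: U_def a_def var_def)
    qed
    moreover have "sE (var w) y = e"
    proof -
      have "\<not> hit (Poly_Mapping.single w 1)"
        using Cons.prems by (auto simp: hit_def lookup_single when_def)
      then show ?thesis using y(2) by (auto simp: U_def a_def var_def)
    qed
    ultimately show ?thesis using y(1) by blast
  qed
  then show ?case using Cons by simp
qed simp

text \<open>Hom(k, N) in degree \<open>r\<close>: a homomorphism from \<open>k\<close> is determined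
  by the image of 1, which all variables kill.\<close>

definition socle :: "(('n::finite, 'k::field) mpoly \<Rightarrow> 'e::ab_group_add \<Rightarrow> 'e) \<Rightarrow> (int \<Rightarrow> 'e set) \<Rightarrow> int \<Rightarrow> 'e set" where
  "socle s N r = {z \<in> N r. \<forall>v. s (var v) z = 0}"

text \<open>The vanishing of Ext^i(k, M) in degree \<open>r\<close>, computed from the complex
  Hom(k, I). At position 0 nothing maps in.\<close>

definition socle_exact :: "(('n::finite, 'k::field) mpoly \<Rightarrow> 'e::ab_group_add \<Rightarrow> 'e) \<Rightarrow>
    (nat \<Rightarrow> int \<Rightarrow> 'e set) \<Rightarrow> (nat \<Rightarrow> 'e \<Rightarrow> 'e) \<Rightarrow> nat \<Rightarrow> int \<Rightarrow> bool" where
  "socle_exact sI I dI i r \<longleftrightarrow> (\<forall>z\<in>socle sI (I i) r. dI i z = 0 \<longrightarrow>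
     (case i of 0 \<Rightarrow> z = 0 | Suc j \<Rightarrow> z \<in> dI j ` socle sI (I j) r))"

text \<open>Each passage to the next module of cocycles lowers the Koszul position by one. This
  works only while injectives are acyclic at both positions, so it stops at position 1; the last
  step compares socles, the cohomology of an injective at position 0.\<close>

lemma koszul_injective_resolution:
  fixes s :: "('n::finite, 'k::field) mpoly \<Rightarrow> 'm::ab_group_add \<Rightarrow> 'm"
    and sI :: "('n, 'k) mpoly \<Rightarrow> 'e::ab_group_add \<Rightarrow> 'e"
  assumes M: "graded_module s M" and res: "graded_injective_resolution s M sI I \<eta> dI"
    and vs: "distinct vs" "set vs = (UNIV :: 'n set)"
  shows "koszul_acyclic (\<lambda>v. s (var v)) M vs (int i) r \<longleftrightarrow> socle_exact sI I dI i r"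
proof -
  have I: "graded_injective sI (I j)" "graded_module sI (I j)" for j
    using res by (auto simp: graded_injective_resolution_def graded_injective_def)
  have eta: "graded_hom s M sI (I 0) \<eta>" and d: "graded_hom sI (I j) sI (I (Suc j)) (dI j)" for j
    using res by (auto simp: graded_injective_resolution_def)
  define Z where "Z j d = {a \<in> I j d. dI j a = 0}" for j d
  have eta_image: "\<eta> ` M d = Z 0 d" for d
    using graded_hom_image[OF M I(2) eta, of d, symmetric] res mem_gcarrier[OF I(2)]
    unfolding Z_def by (auto simp: graded_injective_resolution_def)
  have d_image: "dI j ` I j d = Z (Suc j) d" for j d
    using graded_hom_image[OF I(2) I(2) d, of j d, symmetric] res mem_gcarrier[OF I(2)]
    unfolding Z_def by (auto simp: graded_injective_resolution_def)
  interpret eta: koszul_surj "\<lambda>v. s (var v)" M "\<lambda>v. sI (var v)" "Z 0" \<eta>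
    using graded_hom_koszul_surj[OF M I(2) eta] unfolding eta_image .
  have surj: "koszul_surj (\<lambda>v. sI (var v)) (I j) (\<lambda>v. sI (var v)) (Z (Suc j)) (dI j)" for j
    using graded_hom_koszul_surj[OF I(2) I(2) d] unfolding d_image .
  have ker: "koszul_surj.ker (I j) (dI j) = Z j" for j
    unfolding koszul_surj.ker_def[OF surj] Z_def by (rule ext) simp
  have koszul_acyclic_I: "koszul_acyclic (\<lambda>v. sI (var v)) (I j) vs p r" if "p > 0" for j p
    using koszul_module.koszul_acyclic_coregular[OF graded_module_koszul[OF I(2)] coregular_injective[OF I(1) vs(1)] that] .
  have MZ: "koszul_acyclic (\<lambda>v. s (var v)) M vs (int i) r \<longleftrightarrow> koszul_acyclic (\<lambda>v. sI (var v)) (Z 0) vs (int i) r"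
  proof (rule eta.koszul_acyclic_iso)
    fix a d assume a: "a \<in> M d" "\<eta> a = 0"
    have "inj_on \<eta> (gcarrier M)" using res by (simp add: graded_injective_resolution_def)
    then show "a = 0"
      using a eta.\<phi>_zero mem_gcarrier[OF M a(1)] mem_gcarrier[OF M eta.dom.zero_mem]
      by (metis inj_onD)
  qed
  have shift1: "koszul_acyclic (\<lambda>v. sI (var v)) (Z j) vs (p + 1) r \<longleftrightarrow> koszul_acyclic (\<lambda>v. sI (var v)) (Z (Suc j)) vs p r"
    if "p > 0" for j p
  proof -
    interpret koszul_surj "\<lambda>v. sI (var v)" "I j" "\<lambda>v. sI (var v)" "Z (Suc j)" "dI j" by (rule surj)
    have "koszul_acyclic (\<lambda>v. sI (var v)) (I j) vs (p + 1) r" using koszul_acyclic_I that by simp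
    then have "\<exists>g\<in>cochains (length vs) p r (I j). koszul_d (\<lambda>v. sI (var v)) vs g = f"
      if "f \<in> cochains (length vs) (p + 1) r ker" "koszul_d (\<lambda>v. sI (var v)) vs f = (\<lambda>_. 0)" for f
      using that cochains_ker_iff unfolding koszul_acyclic_def by fastforce
    then show ?thesis using koszul_acyclic_shift[OF _ koszul_acyclic_I[OF that]] unfolding ker by blast
  qed
  have shift: "koszul_acyclic (\<lambda>v. sI (var v)) (Z j) vs (1 + int k) r \<longleftrightarrow> koszul_acyclic (\<lambda>v. sI (var v)) (Z (j + k)) vs 1 r" for j k
  proof (induction k arbitrary: j)
    case (Suc k)
    show ?case using shift1[of "1 + int k" j] Suc[of "Suc j"] by (simp add: algebra_simps)
  qed simp
  show ?thesis
  proof (cases i)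
    case 0
    then show ?thesis
      unfolding MZ by (auto simp: eta.cod.koszul_acyclic_0_iff socle_exact_def socle_def vs Z_def)
  next
    case (Suc k)
    have "koszul_acyclic (\<lambda>v. sI (var v)) (Z 0) vs (int i) r \<longleftrightarrow> koszul_acyclic (\<lambda>v. sI (var v)) (Z k) vs 1 r"
      using shift[of 0 k] Suc by simp
    also have "\<dots> \<longleftrightarrow> (\<forall>e\<in>Z (Suc k) r. (\<forall>v\<in>set vs. sI (var v) e = 0) \<longrightarrow>
        (\<exists>a\<in>I k r. (\<forall>v\<in>set vs. sI (var v) a = 0) \<and> dI k a = e))"
      using koszul_surj.koszul_acyclic_ker_1_iff[OF surj koszul_acyclic_I[of 1 k]] unfolding ker by simp
    also have "\<dots> \<longleftrightarrow> socle_exact sI I dI i r"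
      unfolding Suc socle_exact_def socle_def Z_def vs by auto blast+
    finally show ?thesis using MZ by simp
  qed
qed

section \<open>Local cohomology\<close>

lemma single_in_ideal_power:
  "l \<le> tdeg m \<Longrightarrow> Poly_Mapping.single m 1 \<in> ideal_power (irrelevant_ideal :: ('n::finite, 'k::field) mpoly set) l"
proof (induction l arbitrary: m)
  case (Suc l)
  interpret module "(*) :: ('n, 'k) mpoly \<Rightarrow> _"
    by standard (auto simp: algebra_simps)
  have "tdeg m \<noteq> 0" using Suc.prems by simp
  then obtain v where "Poly_Mapping.lookup m v > 0" unfolding tdeg_def by auto
  then have "m = Poly_Mapping.single v 1 + (m - Poly_Mapping.single v 1)" by (rule monomial_split)
  then obtain m' where m: "m = Poly_Mapping.single v 1 + m'" ..
  have "l \<le> tdeg m'" using Suc.prems unfolding m tdeg_add tdeg_single by simp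
  then have "Poly_Mapping.single m' 1 \<in> ideal_power (irrelevant_ideal :: ('n, 'k) mpoly set) l"
    by (rule Suc.IH)
  moreover have "var v \<in> (irrelevant_ideal :: ('n, 'k) mpoly set)"
    unfolding irrelevant_ideal_def by (rule span_base) simp
  moreover have "Poly_Mapping.single m 1 = (var v :: ('n, 'k) mpoly) * Poly_Mapping.single m' 1"
    unfolding m var_mult_single ..
  ultimately show ?case unfolding ideal_power.simps by (intro span_base) blast
qed simp

lemma keys_ideal_power:
  "p \<in> ideal_power (irrelevant_ideal :: ('n::finite, 'k::field) mpoly set) l \<Longrightarrow>
   m \<in> Poly_Mapping.keys p \<Longrightarrow> l \<le> tdeg m"
proof (induction l arbitrary: p m)
  case (Suc l)
  interpret module "(*) :: ('n, 'k) mpoly \<Rightarrow> _"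
    by standard (auto simp: algebra_simps)
  have "\<forall>m\<in>Poly_Mapping.keys p. Suc l \<le> tdeg m"
    using Suc.prems(1) unfolding ideal_power.simps
  proof (induction rule: span_induct_alt)
    case (step c z y)
    then obtain p q where z: "z = p * q" "p \<in> irrelevant_ideal" "q \<in> ideal_power irrelevant_ideal l"
      by blast
    have "Suc l \<le> tdeg m" if m: "m \<in> Poly_Mapping.keys (c * z)" for m
    proof -
      obtain a b where ab: "m = a + b" "b \<in> Poly_Mapping.keys z" using m keys_mult[of c z] by blast
      obtain b1 b2 where b: "b = b1 + b2" "b1 \<in> Poly_Mapping.keys p" "b2 \<in> Poly_Mapping.keys q"
        using ab(2) keys_mult[of p q] unfolding z(1) by blast
      have "b1 \<noteq> 0" using zero_notin_keys_irrelevant_ideal[OF z(2)] b(2) by auto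
      then have "tdeg b1 \<noteq> 0" by (simp add: tdeg_eq_0_iff)
      then show ?thesis using Suc.IH[OF z(3) b(3)] unfolding ab(1) b(1) tdeg_add by simp
    qed
    then show ?case using step.IH Poly_Mapping.keys_add[of "c * z" y] by blast
  qed simp
  then show ?case using Suc.prems(2) by blast
qed simp

text \<open>Annihilation by R_+^l tested on monomials: this power consists of the polynomials all of
  whose monomials have degree at least \<open>l\<close>.\<close>

definition killed :: "(('n::finite, 'k::field) mpoly \<Rightarrow> 'e::ab_group_add \<Rightarrow> 'e) \<Rightarrow> nat \<Rightarrow> 'e \<Rightarrow> bool" where
  "killed s l a \<longleftrightarrow> (\<forall>m. l \<le> tdeg m \<longrightarrow> s (Poly_Mapping.single m 1) a = 0)"

lemma ideal_power_annihilates_iff: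
  fixes s :: "('n::finite, 'k::field) mpoly \<Rightarrow> 'e::ab_group_add \<Rightarrow> 'e"
  assumes "module s"
  shows "(\<forall>p\<in>ideal_power irrelevant_ideal l. s p a = 0) \<longleftrightarrow> killed s l a"
proof
  interpret module s by fact
  show "killed s l a" if "\<forall>p\<in>ideal_power irrelevant_ideal l. s p a = 0"
    using that single_in_ideal_power unfolding killed_def by blast
  show "\<forall>p\<in>ideal_power irrelevant_ideal l. s p a = 0" if k: "killed s l a"
  proof
    fix p :: "('n, 'k) mpoly" assume p: "p \<in> ideal_power irrelevant_ideal l"
    have "s p a = (\<Sum>m\<in>Poly_Mapping.keys p. s (Poly_Mapping.single m (Poly_Mapping.lookup p m)) a)"
      using arg_cong[OF mpoly_sum_monomials[of p], of "\<lambda>q. s q a"] by (simp only: scale_sum_left)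
    also have "\<dots> = 0"
    proof (rule sum.neutral, rule ballI)
      fix m assume "m \<in> Poly_Mapping.keys p"
      then have "s (Poly_Mapping.single m 1) a = 0"
        using keys_ideal_power[OF p] k unfolding killed_def by blast
      then have "s (Poly_Mapping.single 0 (Poly_Mapping.lookup p m)) (s (Poly_Mapping.single m 1) a) = 0"
        by simp
      then show "s (Poly_Mapping.single m (Poly_Mapping.lookup p m)) a = 0"
        by (simp add: mult_single)
    qed
    finally show "s p a = 0" .
  qed
qed

lemma killed_mono: "killed s l a \<Longrightarrow> l \<le> l' \<Longrightarrow> killed s l' a"
  by (auto simp: killed_def)

lemma killed_1_iff:
  fixes s :: "('n::finite, 'k::field) mpoly \<Rightarrow> 'e::ab_group_add \<Rightarrow> 'e"
  assumes "module s"
  shows "killed s 1 a \<longleftrightarrow> (\<forall>v. s (var v) a = 0)"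
proof
  interpret module s by fact
  show "\<forall>v. s (var v) a = 0" if "killed s 1 a"
    using that by (simp add: killed_def var_def)
  show "killed s 1 a" if k: "\<forall>v. s (var v) a = 0"
    unfolding killed_def
  proof (intro allI impI)
    fix m :: "'n \<Rightarrow>\<^sub>0 nat" assume "1 \<le> tdeg m"
    then have "tdeg m \<noteq> 0" by simp
    then obtain v where "Poly_Mapping.lookup m v > 0" unfolding tdeg_def by auto
    then have "m = Poly_Mapping.single v 1 + (m - Poly_Mapping.single v 1)" by (rule monomial_split)
  then obtain m' where m: "m = Poly_Mapping.single v 1 + m'" ..
    have "s (Poly_Mapping.single m 1) a = s (Poly_Mapping.single m' 1) (s (var v) a)"
      unfolding m by (simp only: scale_scale mult.commute[of _ "var v"] var_mult_single)
    then show "s (Poly_Mapping.single m 1) a = 0" using k by simp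
  qed
qed

section \<open>The torsion complex of an injective resolution and its comparison with the socle
  complex\<close>

locale injective_resolution =
  fixes s :: "('n::finite, 'k::field) mpoly \<Rightarrow> 'm::ab_group_add \<Rightarrow> 'm" and M
    and sI :: "('n, 'k) mpoly \<Rightarrow> 'e::ab_group_add \<Rightarrow> 'e" and I \<eta> dI
  assumes res: "graded_injective_resolution s M sI I \<eta> dI"
begin

lemma inj: "graded_injective sI (I i)"
  using res by (simp add: graded_injective_resolution_def)

lemma I: "graded_module sI (I i)"
  using inj by (simp add: graded_injective_def)

sublocale module sI by (rule graded_module_module[OF I])

lemma dI_hom: "graded_hom sI (I i) sI (I (Suc i)) (dI i)"
  using res by (simp add: graded_injective_resolution_def)

lemma dI_mem: "a \<in> I i d \<Longrightarrow> dI i a \<in> I (Suc i) d"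
  using dI_hom[of i] unfolding graded_hom_def by blast

lemma dI_scale: "a \<in> I i d \<Longrightarrow> dI i (sI p a) = sI p (dI i a)"
  using dI_hom[of i] mem_gcarrier[OF I] unfolding graded_hom_def by blast

lemma dI_add: "a \<in> I i d \<Longrightarrow> b \<in> I i d \<Longrightarrow> dI i (a + b) = dI i a + dI i b"
  using dI_hom[of i] mem_gcarrier[OF I] unfolding graded_hom_def by blast

lemma dI_zero [simp]: "dI i 0 = 0"
  using dI_add[OF graded_module_zero[OF I] graded_module_zero[OF I]] by simp

lemma dI_diff: "a \<in> I i d \<Longrightarrow> b \<in> I i d \<Longrightarrow> dI i (a - b) = dI i a - dI i b"
  using dI_add[OF graded_module_diff[OF I], of a i d b b] by simp

lemma dI_dI: "a \<in> I i d \<Longrightarrow> dI (Suc i) (dI i a) = 0"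
proof -
  assume "a \<in> I i d"
  then have "dI i a \<in> dI i ` gcarrier (I i)" using mem_gcarrier[OF I] by blast
  also have "\<dots> = {x \<in> gcarrier (I (Suc i)). dI (Suc i) x = 0}"
    using res unfolding graded_injective_resolution_def by blast
  finally show ?thesis by simp
qed

lemma torsion_iff:
  "a \<in> torsion_part irrelevant_ideal sI (I i) r \<longleftrightarrow> a \<in> I i r \<and> (\<exists>l. killed sI l a)"
  unfolding torsion_part_def ideal_power_annihilates_iff[OF module_axioms] by simp

lemma torsion_diff:
  assumes "a \<in> torsion_part irrelevant_ideal sI (I i) r" "b \<in> torsion_part irrelevant_ideal sI (I i) r"
  shows "a - b \<in> torsion_part irrelevant_ideal sI (I i) r"
proof -
  obtain l l' where "killed sI l a" "killed sI l' b" using assms torsion_iff by blast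
  then have "killed sI (max l l') (a - b)" unfolding killed_def by (simp add: scale_right_diff_distrib)
  then show ?thesis using assms graded_module_diff[OF I] unfolding torsion_iff by blast
qed

lemma torsion_zero: "0 \<in> torsion_part irrelevant_ideal sI (I i) r"
  unfolding torsion_iff by (simp add: killed_def graded_module_zero[OF I])

lemma coboundaries_zero: "0 \<in> lc_coboundaries sI I dI i r"
  unfolding lc_coboundaries_def using torsion_zero dI_zero by (force split: nat.split)

lemma coboundaries_diff:
  assumes "a \<in> lc_coboundaries sI I dI i r" "b \<in> lc_coboundaries sI I dI i r"
  shows "a - b \<in> lc_coboundaries sI I dI i r"
proof (cases i)
  case (Suc j)
  then obtain a' b' where ab: "a = dI j a'" "b = dI j b'"
      "a' \<in> torsion_part irrelevant_ideal sI (I j) r" "b' \<in> torsion_part irrelevant_ideal sI (I j) r"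
    using assms by (auto simp: lc_coboundaries_def)
  then have "a - b = dI j (a' - b')" using dI_diff torsion_iff by metis
  then show ?thesis using torsion_diff[OF ab(3,4)] Suc by (simp add: lc_coboundaries_def)
qed (use assms in \<open>simp add: lc_coboundaries_def\<close>)

lemma coboundaries_add:
  "a \<in> lc_coboundaries sI I dI i r \<Longrightarrow> b \<in> lc_coboundaries sI I dI i r \<Longrightarrow>
   a + b \<in> lc_coboundaries sI I dI i r"
  using coboundaries_diff[of a i r "0 - b"] coboundaries_diff[OF coboundaries_zero, of b i r] by simp

lemma coboundaries_subset: "lc_coboundaries sI I dI i r \<subseteq> lc_cocycles sI I dI i r"
proof
  fix z assume z: "z \<in> lc_coboundaries sI I dI i r"
  show "z \<in> lc_cocycles sI I dI i r"
  proof (cases i)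
    case 0
    then show ?thesis using z torsion_zero by (simp add: lc_coboundaries_def lc_cocycles_def)
  next
    case (Suc j)
    then obtain a where a: "z = dI j a" "a \<in> I j r" "\<exists>l. killed sI l a"
      using z by (auto simp: lc_coboundaries_def torsion_iff)
    have "killed sI l z" if "killed sI l a" for l
      using that dI_scale[OF a(2), symmetric] unfolding killed_def a(1) by simp
    then show ?thesis
      using a dI_mem[OF a(2)] dI_dI[OF a(2)] unfolding Suc lc_cocycles_def torsion_iff by blast
  qed
qed

lemma local_cohomology_trivial_iff:
  "local_cohomology sI I dI i r = {lc_coboundaries sI I dI i r} \<longleftrightarrow>
   lc_cocycles sI I dI i r \<subseteq> lc_coboundaries sI I dI i r"
proof -
  let ?Z = "lc_cocycles sI I dI i r" and ?B = "lc_coboundaries sI I dI i r"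
  let ?R = "{(x, y). x \<in> ?Z \<and> y \<in> ?Z \<and> x - y \<in> ?B}"
  have lc: "local_cohomology sI I dI i r = (\<lambda>x. ?R `` {x}) ` ?Z"
    unfolding local_cohomology_def quotient_def by auto
  show ?thesis
  proof
    assume L: "local_cohomology sI I dI i r = {?B}"
    show "?Z \<subseteq> ?B"
    proof
      fix z assume z: "z \<in> ?Z"
      then have "?R `` {z} \<in> local_cohomology sI I dI i r" unfolding lc by (rule imageI)
      then have "?R `` {z} = ?B" unfolding L by (rule singletonD)
      moreover have "z \<in> ?R `` {z}" using z coboundaries_zero by simp
      ultimately show "z \<in> ?B" by blast
    qed
  next
    assume sub: "?Z \<subseteq> ?B"
    then have eq: "?Z = ?B" using coboundaries_subset by blast
    have "?R `` {z} = ?B" if "z \<in> ?Z" for z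
      using that coboundaries_diff unfolding eq by auto
    then have "(\<lambda>x. ?R `` {x}) ` ?Z = (\<lambda>_. ?B) ` ?Z" by (rule image_cong[OF refl])
    also have "\<dots> = {?B}" unfolding eq using coboundaries_zero[of i r] by (intro image_constant)
    finally show "local_cohomology sI I dI i r = {?B}" unfolding lc .
  qed
qed

text \<open>An element killed by \<open>R\<^sub>+\<^sup>l\<^sup>+\<^sup>1\<close> is sent into the socle by the monomials of degree \<open>l\<close>. Exactness
  of the socle complex and injectivity then yield a coboundary with the same products by these
  monomials, and subtracting it lowers \<open>l\<close>.\<close>

lemma reduce_torsion:
  assumes exact: "\<And>r'. r' \<ge> r + int c \<Longrightarrow> socle_exact sI I dI i r'"
    and "a \<in> I i r" "killed sI l a" "killed sI c (dI i a)"
  shows "\<exists>w\<in>lc_coboundaries sI I dI i r. killed sI c (a - w)"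
  using assms(2-)
proof (induction l arbitrary: a)
  case 0
  then have "killed sI c (a - 0)" using killed_mono[OF 0(2)] by simp
  then show ?case using coboundaries_zero by blast
next
  case (Suc l)
  note IH = Suc.IH and prems = Suc.prems
  show ?case
  proof (cases "Suc l \<le> c")
    case True
    then have "killed sI c (a - 0)" using killed_mono[OF prems(2)] by simp
    then show ?thesis using coboundaries_zero by blast
  next
    case False
    have soc: "sI (Poly_Mapping.single m 1) a \<in> socle sI (I i) (r + int l) \<and> dI i (sI (Poly_Mapping.single m 1) a) = 0"
      if m: "tdeg m = l" for m
    proof -
      have "sI (var v) (sI (Poly_Mapping.single m 1) a) = 0" for v
      proof -
        have "tdeg (Poly_Mapping.single v 1 + m) = Suc l" using m by (simp add: tdeg_add)
        then have "sI (Poly_Mapping.single (Poly_Mapping.single v 1 + m) 1) a = 0"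
          using prems(2) unfolding killed_def by (metis order_refl)
        then show ?thesis by (simp only: scale_scale var_mult_single)
      qed
      moreover have "sI (Poly_Mapping.single m 1) a \<in> I i (r + int l)"
        using graded_module_scale[OF I prems(1), of m 1] m by simp
      \<comment> \<open>Here the bound \<open>c\<close> limits the descent: as l \<ge> c, the
        monomials of degree \<open>l\<close> also kill \<open>dI i a\<close>, so the products are
        cocycles. Their degrees r + l are those for which exactness is assumed.\<close>
      moreover have "sI (Poly_Mapping.single m 1) (dI i a) = 0"
        using prems(3) m False unfolding killed_def by simp
      ultimately show ?thesis using dI_scale[OF prems(1)] by (simp add: socle_def)
    qed
    have ex: "socle_exact sI I dI i (r + int l)" using exact False by simp
    show ?thesis
    proof (cases i)
      case 0
      \<comment> \<open>At position 0 nothing can be subtracted; exactness says that the products by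
        monomials of degree \<open>l\<close> are already 0.\<close>
      have "killed sI l a" unfolding killed_def
      proof (intro allI impI)
        fix m :: "'n \<Rightarrow>\<^sub>0 nat" assume m: "l \<le> tdeg m"
        show "sI (Poly_Mapping.single m 1) a = 0"
        proof (cases "tdeg m = l")
          case True
          then show ?thesis using soc[OF True] ex unfolding socle_exact_def 0 by simp
        next
          case False
          then show ?thesis using prems(2) m unfolding killed_def by simp
        qed
      qed
      then show ?thesis using IH prems by blast
    next
      case (Suc j)
      have "\<exists>b. b \<in> socle sI (I j) (r + int l) \<and> dI j b = sI (Poly_Mapping.single m 1) a"
        if "tdeg m = l" for m
        using soc[OF that] ex unfolding socle_exact_def Suc by (auto simp del: One_nat_def) (metis imageE)
      then obtain b where b: "\<And>m. tdeg m = l \<Longrightarrow>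
          b m \<in> socle sI (I j) (r + int l) \<and> dI j (b m) = sI (Poly_Mapping.single m 1) a"
        by metis
      \<comment> \<open>The values \<open>b m\<close> in degree \<open>l\<close> and 0 above define
        a homomorphism on R_+^l: steps by a variable lead from degree \<open>l\<close> to larger
        degrees, where 0 is the right value because each \<open>b m\<close> lies in the
        socle.\<close>
      have "\<exists>y\<in>I j r. \<forall>m\<in>{m. l \<le> tdeg m}. sI (Poly_Mapping.single m 1) y = (if tdeg m = l then b m else 0)"
      proof (rule injective_extend_monomials[OF inj])
        fix m :: "'n \<Rightarrow>\<^sub>0 nat" and v assume m: "m \<in> {m. l \<le> tdeg m}"
        then show "Poly_Mapping.single v 1 + m \<in> {m. l \<le> tdeg m}" by (simp add: tdeg_add)
        show "(if tdeg m = l then b m else 0) \<in> I j (r + int (tdeg m))"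
          using b[of m] graded_module_zero[OF I] by (auto simp: socle_def)
        show "(if tdeg (Poly_Mapping.single v 1 + m) = l then b (Poly_Mapping.single v 1 + m) else 0) =
            sI (var v) (if tdeg m = l then b m else 0)"
          using m b[of m] by (auto simp: tdeg_add socle_def)
      qed
      then obtain y where y: "y \<in> I j r"
          "\<And>m. l \<le> tdeg m \<Longrightarrow> sI (Poly_Mapping.single m 1) y = (if tdeg m = l then b m else 0)"
        by blast
      \<comment> \<open>The value 0 above degree \<open>l\<close> makes \<open>y\<close> a torsion
        element, so \<open>dI j y\<close> is a coboundary of the torsion complex.\<close>
      have "killed sI (Suc l) y" using y(2) unfolding killed_def by simp
      then have cob: "dI j y \<in> lc_coboundaries sI I dI i r"
        using y(1) torsion_iff unfolding Suc lc_coboundaries_def by (auto intro!: imageI)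
      have dy: "dI j y \<in> I i r" "dI i (dI j y) = 0" using dI_mem[OF y(1)] dI_dI[OF y(1)] Suc by auto
      have "killed sI l (a - dI j y)" unfolding killed_def
      proof (intro allI impI)
        fix m :: "'n \<Rightarrow>\<^sub>0 nat" assume m: "l \<le> tdeg m"
        have "sI (Poly_Mapping.single m 1) (a - dI j y) =
            sI (Poly_Mapping.single m 1) a - dI j (if tdeg m = l then b m else 0)"
          using y(2)[OF m] dI_scale[OF y(1), of "Poly_Mapping.single m 1"] by (simp add: scale_right_diff_distrib)
        then show "sI (Poly_Mapping.single m 1) (a - dI j y) = 0"
          using b[of m] prems(2) m unfolding killed_def by auto
      qed
      moreover have "a - dI j y \<in> I i r" using graded_module_diff[OF I prems(1) dy(1)] .
      moreover have "killed sI c (dI i (a - dI j y))"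
        using dI_diff[OF prems(1) dy(1)] dy(2) prems(3) by simp
      ultimately obtain w where w: "w \<in> lc_coboundaries sI I dI i r" "killed sI c (a - dI j y - w)"
        using IH by blast
      then have "killed sI c (a - (dI j y + w))" by (simp add: algebra_simps)
      then show ?thesis using coboundaries_add[OF cob w(1)] by blast
    qed
  qed
qed

text \<open>The descent with \<open>c = 0\<close>: a cocycle has image 0, and an element killed by
  R_+^0, the whole ring, is 0.\<close>

lemma local_cohomology_trivialI:
  assumes "\<And>r'. r' \<ge> r \<Longrightarrow> socle_exact sI I dI i r'"
  shows "local_cohomology sI I dI i r = {lc_coboundaries sI I dI i r}"
  unfolding local_cohomology_trivial_iff
proof
  fix z assume "z \<in> lc_cocycles sI I dI i r"
  then obtain l where z: "z \<in> I i r" "killed sI l z" "dI i z = 0"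
    by (auto simp: lc_cocycles_def torsion_iff)
  have "killed sI 0 (dI i z)" using z(3) by (simp add: killed_def)
  then obtain w where w: "w \<in> lc_coboundaries sI I dI i r" "killed sI 0 (z - w)"
    using reduce_torsion[of r 0 i z l] assms z by auto
  then have "sI (Poly_Mapping.single 0 1) (z - w) = 0" unfolding killed_def by blast
  then have "z = w" by simp
  then show "z \<in> lc_coboundaries sI I dI i r" using w(1) by simp
qed

text \<open>Suppose a socle cocycle is the image of a torsion element \<open>y\<close>. The descent
  with \<open>c = 1\<close>, one position lower, moves \<open>y\<close> into the socle without
  changing its image. It meets only degrees at least r + 1, hence the strict inequality in the
  assumption.\<close>

lemma local_cohomology_nontrivialI:
  assumes "\<not> socle_exact sI I dI i r"
    and "\<And>j r'. i = Suc j \<Longrightarrow> r' > r \<Longrightarrow> socle_exact sI I dI j r'"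
  shows "local_cohomology sI I dI i r \<noteq> {lc_coboundaries sI I dI i r}"
proof
  assume "local_cohomology sI I dI i r = {lc_coboundaries sI I dI i r}"
  then have triv: "lc_cocycles sI I dI i r \<subseteq> lc_coboundaries sI I dI i r"
    by (simp add: local_cohomology_trivial_iff)
  obtain z where z: "z \<in> socle sI (I i) r" "dI i z = 0"
      "\<not> (case i of 0 \<Rightarrow> z = 0 | Suc j \<Rightarrow> z \<in> dI j ` socle sI (I j) r)"
    using assms(1) unfolding socle_exact_def by blast
  have soc: "a \<in> socle sI (I j) r \<longleftrightarrow> a \<in> I j r \<and> killed sI 1 a" for a j
    unfolding socle_def killed_1_iff[OF module_axioms] by blast
  have "z \<in> lc_cocycles sI I dI i r"
    using z(1,2) soc unfolding lc_cocycles_def torsion_iff by blast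
  then have cob: "z \<in> lc_coboundaries sI I dI i r" using triv by blast
  show False
  proof (cases i)
    case 0
    then show ?thesis using cob z(3) by (simp add: lc_coboundaries_def)
  next
    case (Suc j)
    then obtain y l where y: "z = dI j y" "y \<in> I j r" "killed sI l y"
      using cob by (auto simp: lc_coboundaries_def torsion_iff)
    have "killed sI 1 (dI j y)" using z(1) soc y(1) by simp
    then obtain w where w: "w \<in> lc_coboundaries sI I dI j r" "killed sI 1 (y - w)"
      using reduce_torsion[of r 1 j y l] assms(2)[OF Suc] y by auto
    have "w \<in> I j r" "dI j w = 0"
      using w(1) coboundaries_subset by (auto simp: lc_cocycles_def torsion_iff)
    then have "y - w \<in> socle sI (I j) r" "dI j (y - w) = z"
      using w(2) y soc graded_module_diff[OF I] dI_diff by auto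
    then show ?thesis using z(3) Suc by auto
  qed
qed

lemma local_cohomology_witness:
  "\<not> socle_exact sI I dI i r \<Longrightarrow>
   \<exists>i' r'. i' \<le> i \<and> r' \<ge> r \<and> r' + int i' \<ge> r + int i \<and>
     local_cohomology sI I dI i' r' \<noteq> {lc_coboundaries sI I dI i' r'}"
proof (induction i arbitrary: r)
  case 0
  then show ?case using local_cohomology_nontrivialI[of 0 r] by auto
next
  case (Suc i)
  show ?case
  proof (cases "\<forall>r'>r. socle_exact sI I dI i r'")
    case True
    then show ?thesis using local_cohomology_nontrivialI[of "Suc i" r] Suc.prems
      by (intro exI[of _ "Suc i"] exI[of _ r]) auto
  next
    case False
    \<comment> \<open>The position drops by one while the degree grows by at least one, so the sum
      of both does not decrease.\<close>
    then obtain r1 where r1: "r1 > r" "\<not> socle_exact sI I dI i r1" by blast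
    obtain i' r' where "i' \<le> i" "r' \<ge> r1" "r' + int i' \<ge> r1 + int i"
        "local_cohomology sI I dI i' r' \<noteq> {lc_coboundaries sI I dI i' r'}"
      using Suc.IH[OF r1(2)] by blast
    then show ?thesis using r1(1) by (intro exI[of _ i'] exI[of _ r']) auto
  qed
qed

end

section \<open>From vanishing in single degrees to suprema and maxima\<close>

theorem theorem5p1:
  fixes s :: "('n::finite, 'k::field) mpoly \<Rightarrow> 'm::ab_group_add \<Rightarrow> 'm"
    and M :: "int \<Rightarrow> 'm set"
    and sI :: "('n, 'k) mpoly \<Rightarrow> 'e::ab_group_add \<Rightarrow> 'e"
    and I :: "nat \<Rightarrow> int \<Rightarrow> 'e set"
    and \<eta> :: "'m \<Rightarrow> 'e"
    and dI :: "nat \<Rightarrow> 'e \<Rightarrow> 'e"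
    and sF :: "('n, 'k) mpoly \<Rightarrow> 'f::ab_group_add \<Rightarrow> 'f"
    and F :: "nat \<Rightarrow> int \<Rightarrow> 'f set"
    and B :: "nat \<Rightarrow> 'f set"
    and \<epsilon> :: "'f \<Rightarrow> 'm"
    and \<delta> :: "nat \<Rightarrow> 'f \<Rightarrow> 'f"
    and t :: nat
  assumes "graded_module s M"
    and "finitely_generated s M"
    and "graded_injective_resolution s M sI I \<eta> dI"
    and "minimal_graded_free_resolution s M sF F B \<epsilon> \<delta>"
  shows "partial_reg sI I dI t =
           Max {b_inv F B i - ereal (real_of_int i) | i. i \<ge> int CARD('n) - int t} \<and>
         partial_a_star sI I dI t =
           Max {b_inv F B i | i. i \<ge> int CARD('n) - int t} - ereal (real CARD('n))"
proof -
  define n where "n = CARD('n)"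
  obtain vs :: "'n list" where vs: "distinct vs" "set vs = UNIV"
    using finite_distinct_list[of "UNIV :: 'n set"] by auto
  then have len: "length vs = n" unfolding n_def using distinct_card[OF vs(1)] by simp
  interpret injective_resolution s M sI I \<eta> dI by standard fact
  interpret M: koszul_module "\<lambda>v. s (var v)" M by (rule graded_module_koszul) fact
  note K = koszul_injective_resolution[OF assms(1,3) vs]
    koszul_minimal_resolution[OF assms(1,4) vs, unfolded len]
  let ?a = "a_inv sI I dI" and ?b = "b_inv F B"
  have socle: "i \<le> n \<and> B (n - i) \<inter> F (n - i) (r + int n) \<noteq> {}" if "\<not> socle_exact sI I dI i r" for i r
  proof -
    have "i \<le> n" using that M.koszul_acyclic_outside[of "int i" vs r] K(1) len by force
    then show ?thesis using that K(1)[of i r] K(2)[of "n - i" r] by (simp add: of_nat_diff)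
  qed
  have generator: "j \<le> n \<and> \<not> socle_exact sI I dI (n - j) (D - int n)" if "B j \<inter> F j D \<noteq> {}" for j D
  proof -
    \<comment> \<open>For j > n the Koszul position n - j is negative and carries only the zero
      cochain, so \<open>F j\<close> has no generators.\<close>
    have "j \<le> n" using that M.koszul_acyclic_outside[of "int n - int j" vs "D - int n"] K(2)[of j "D - int n"] len
      by force
    then show ?thesis using that K(1)[of "n - j" "D - int n"] K(2)[of j "D - int n"] by (simp add: of_nat_diff)
  qed
  have a_le: "?a i \<le> ?b (int n - int i) - ereal (real n)" for i
    unfolding a_inv_def
  proof (rule Sup_least)
    fix z assume "z \<in> {ereal (real_of_int r) |r. local_cohomology sI I dI i r \<noteq> {lc_coboundaries sI I dI i r}}"
    then obtain r where r: "z = ereal (real_of_int r)"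
        "local_cohomology sI I dI i r \<noteq> {lc_coboundaries sI I dI i r}" by blast
    then obtain r' where r': "r' \<ge> r" "\<not> socle_exact sI I dI i r'"
      using local_cohomology_trivialI by blast
    then have *: "i \<le> n" "B (n - i) \<inter> F (n - i) (r' + int n) \<noteq> {}" using socle by blast+
    then have "\<not> int n - int i < 0" "nat (int n - int i) = n - i" by simp_all
    then have "ereal (real_of_int (r' + int n)) \<le> ?b (int n - int i)"
      unfolding b_inv_def using *(2) by (simp only: if_False) (rule Sup_upper, blast)
    moreover have "z + ereal (real n) \<le> ereal (real_of_int (r' + int n))" using r r'(1) by simp
    ultimately have "z + ereal (real n) \<le> ?b (int n - int i)" by (rule order_trans[rotated])
    then show "z \<le> ?b (int n - int i) - ereal (real n)"
      using r(1) by (cases "?b (int n - int i)") auto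
  qed
  \<comment> \<open>One estimate serves both formulas: a generator of degree \<open>D\<close> yields
    a nonzero local cohomology degree \<open>r\<close> with both inequalities for \<open>D\<close>.
    Formula (a) uses the one with \<open>r + int i + j\<close>, formula (b) the one with
    \<open>r + int n\<close>.\<close>
  have b_le: "?b j \<le> c"
    if j: "j \<ge> int n - int t"
      and c: "\<And>i r D. i \<le> t \<Longrightarrow> ereal (real_of_int r) \<le> ?a i \<Longrightarrow>
        D \<le> r + int n \<Longrightarrow> D \<le> r + int i + j \<Longrightarrow> ereal (real_of_int D) \<le> c" for j c
  proof (cases "j < 0")
    case True
    then show ?thesis by (simp add: b_inv_def)
  next
    case False
    have "z \<le> c" if "z \<in> {ereal (real_of_int D) |D. B (nat j) \<inter> F (nat j) D \<noteq> {}}" for z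
    proof -
      obtain D where D: "z = ereal (real_of_int D)" "B (nat j) \<inter> F (nat j) D \<noteq> {}"
        using \<open>z \<in> _\<close> by blast
      have jn: "nat j \<le> n" "\<not> socle_exact sI I dI (n - nat j) (D - int n)"
        using generator[OF D(2)] by blast+
      obtain i r where ir: "i \<le> n - nat j" "r \<ge> D - int n" "r + int i \<ge> D - int n + int (n - nat j)"
          "local_cohomology sI I dI i r \<noteq> {lc_coboundaries sI I dI i r}"
        using local_cohomology_witness[OF jn(2)] by blast
      have "ereal (real_of_int r) \<le> ?a i"
        unfolding a_inv_def using ir(4) by (intro Sup_upper) blast
      then show ?thesis unfolding D(1) using c[of i r D] ir jn(1) j False by auto
    qed
    then have "Sup {ereal (real_of_int D) |D. B (nat j) \<inter> F (nat j) D \<noteq> {}} \<le> c" by (rule Sup_least)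
    then show ?thesis using False by (simp add: b_inv_def)
  qed
  have b_large: "?b j = -\<infinity>" if "j > int n" for j
  proof -
    have "\<not> nat j \<le> n" using that by linarith
    then have "B (nat j) \<inter> F (nat j) D = {}" for D using generator by blast
    then show ?thesis by (simp add: b_inv_def bot_ereal_def)
  qed
  let ?J = "{j. j \<ge> int n - int t}"
  \<comment> \<open>The index set is unbounded above, but beyond n only the value -\<infinity> is
    added; so the maxima are taken over finite sets.\<close>
  have fin: "finite (f ` ?J)" if "\<And>j. ?b j = -\<infinity> \<Longrightarrow> f j = -\<infinity>" for f :: "int \<Rightarrow> ereal"
  proof (rule finite_subset)
    show "f ` ?J \<subseteq> f ` {int n - int t..int n} \<union> {-\<infinity>}"
      using that b_large by (force simp: not_le)
  qed simp
  \<comment> \<open>Position \<open>i\<close> of local cohomology is matched with index n - i of the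
    resolution. For i > n this index is negative, where \<open>b_inv\<close> is
    -\<infinity>.\<close>
  have J: "int n - int i \<in> ?J" if "i \<le> t" for i using that by simp
  have ne: "?J \<noteq> {}" using J[of 0] by blast
  let ?A = "(\<lambda>i. ?a i + ereal (real i)) ` {..t}" and ?A' = "?a ` {..t}"
  let ?S = "(\<lambda>j. ?b j - ereal (real_of_int j)) ` ?J" and ?S' = "?b ` ?J"
  have finS: "finite ?S" "finite ?S'" by (intro fin; simp)+
  have "Max ?A \<le> Max ?S"
  proof (rule Max.boundedI)
    fix z assume "z \<in> ?A"
    then obtain i where i: "i \<le> t" "z = ?a i + ereal (real i)" by blast
    have "z \<le> ?b (int n - int i) - ereal (real_of_int (int n - int i))"
      unfolding i(2) using a_le[of i] by (cases "?b (int n - int i)"; cases "?a i") auto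
    also have "\<dots> \<le> Max ?S" using finS(1) J[OF i(1)] by (intro Max_ge imageI)
    finally show "z \<le> Max ?S" .
  qed auto
  moreover have "Max ?S \<le> Max ?A"
  proof (rule Max.boundedI)
    fix z assume "z \<in> ?S"
    then obtain j where j: "j \<ge> int n - int t" "z = ?b j - ereal (real_of_int j)" by blast
    have "?b j \<le> Max ?A + ereal (real_of_int j)"
    proof (rule b_le[OF j(1)])
      fix i r D assume *: "i \<le> t" "ereal (real_of_int r) \<le> ?a i" "D \<le> r + int i + j"
      have "ereal (real_of_int D) \<le> ereal (real_of_int r) + ereal (real i) + ereal (real_of_int j)"
        using *(3) by simp
      also have "\<dots> \<le> ?a i + ereal (real i) + ereal (real_of_int j)"
        using *(2) by (intro add_mono order_refl)
      also have "\<dots> \<le> Max ?A + ereal (real_of_int j)"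
        using *(1) by (intro add_mono order_refl Max_ge) auto
      finally show "ereal (real_of_int D) \<le> Max ?A + ereal (real_of_int j)" .
    qed
    then show "z \<le> Max ?A" unfolding j(2) by (cases "?b j"; cases "Max ?A") auto
  qed (use finS ne in auto)
  moreover have "Max ?A' \<le> Max ?S' - ereal (real n)"
  proof (rule Max.boundedI)
    fix z assume "z \<in> ?A'"
    then obtain i where i: "i \<le> t" "z = ?a i" by blast
    have "z \<le> ?b (int n - int i) - ereal (real n)" unfolding i(2) by (rule a_le)
    also have "\<dots> \<le> Max ?S' - ereal (real n)"
      using finS(2) J[OF i(1)] by (intro ereal_minus_mono order_refl Max_ge imageI)
    finally show "z \<le> Max ?S' - ereal (real n)" .
  qed auto
  moreover have "Max ?S' - ereal (real n) \<le> Max ?A'"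
  proof -
    have "Max ?S' \<le> Max ?A' + ereal (real n)"
    proof (rule Max.boundedI)
      fix z assume "z \<in> ?S'"
      then obtain j where j: "j \<ge> int n - int t" "z = ?b j" by blast
      show "z \<le> Max ?A' + ereal (real n)"
        unfolding j(2)
      proof (rule b_le[OF j(1)])
        fix i r D assume *: "i \<le> t" "ereal (real_of_int r) \<le> ?a i" "D \<le> r + int n"
        have "ereal (real_of_int D) \<le> ereal (real_of_int r) + ereal (real n)"
          using *(3) by simp
        also have "\<dots> \<le> Max ?A' + ereal (real n)"
          using *(1,2) by (intro add_mono order_refl order_trans[OF *(2)] Max_ge) auto
        finally show "ereal (real_of_int D) \<le> Max ?A' + ereal (real n)" .
      qed
    qed (use finS ne in auto)
    then show ?thesis by (cases "Max ?S'"; cases "Max ?A'") auto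
  qed
  moreover have "{?a i + ereal (real i) |i. i \<le> t} = ?A" "{?a i |i. i \<le> t} = ?A'"
    "{?b j - ereal (real_of_int j) |j. j \<ge> int n - int t} = ?S" "{?b j |j. j \<ge> int n - int t} = ?S'"
    by auto
  ultimately show ?thesis
    unfolding partial_reg_def partial_a_star_def n_def[symmetric] by (simp only: order.antisym)
qed

end
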